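(* If $0<s<d$, then $$\lim_{N\to\infty}\frac{\mathcal E_s^{\mathrm p}(\Omega,N)}{N^2}=\int_\Omega\int_\Omega K_s^{\mathrm p}(x,y)\,dx\,dy=\frac{2\pi^{d/2}}{\Gamma(\frac s2)(d-s)}.$$
   Context: Let $V$ be a real $d\times d$ matrix with linearly independent columns $v_1,\dots,v_d$ and $\det V=1$; $\mathcal V=\{Vk:k\in\mathbb Z^d\}$; $\mathcal V^*=\{w\in\mathbb R^d: w\cdot v\in\mathbb Z\ \forall v\in\mathcal V\}$; $\Omega=\{\sum_j\alpha_jv_j:\alpha_j\in[0,1)\}$. Periodic Riesz energy: for $s>0$ let $d\mu_s(t)=\Gamma(s/2)^{-1}t^{s/2-1}\,dt$ on $(0,\infty)$ and $$K_s^{\mathrm p}(x,y)=\sum_{v\in\mathcal V}\int_1^\infty e^{-|x-y+v|^2t}\,d\mu_s(t)+\sum_{w\in\mathcal V^*\setminus\{0\}}e^{2\pi i w\cdot(x-y)}\int_0^1\frac{\pi^{d/2}}{t^{d/2}}e^{-\pi^2|w|^2/t}\,d\mu_s(t).$$ Then $\mathcal E_s^{\mathrm p}(\Omega,N)=\inf\{\sum_{j\ne k}K_s^{\mathrm p}(x_j,x_k):(x_j)_{j=1}^N\in\Omega^N\}$. *)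

theory Defs
  imports "HOL-Analysis.Analysis"
begin

definition lattice_of :: "real^'d^'d \<Rightarrow> (real^'d) set" where
  "lattice_of V = {V *v k | k. \<forall>i. k $ i \<in> \<int>}"

definition dual_lattice :: "real^'d^'d \<Rightarrow> (real^'d) set" where
  "dual_lattice V = {w. \<forall>v\<in>lattice_of V. w \<bullet> v \<in> \<int>}"

definition fund_domain :: "real^'d^'d \<Rightarrow> (real^'d) set" where
  "fund_domain V = {(\<Sum>j\<in>UNIV. \<alpha> j *\<^sub>R column j V) | \<alpha>. \<forall>j. 0 \<le> \<alpha> j \<and> \<alpha> j < 1}"

definition riesz_measure :: "real \<Rightarrow> real measure" where
  "riesz_measure s =
     density lborel (\<lambda>t. ennreal (indicator {0<..} t * (t powr (s/2 - 1) / Gamma (s/2))))"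

text \<open>The lattice sum is taken in \<^typ>\<open>ennreal\<close>, so that the kernel is \<open>\<infinity>\<close> when \<open>x - y\<close> lies in
  the lattice. The dual sum is invariant under conjugation (replace \<open>w\<close> by \<open>-w\<close>), hence real;
  \<^const>\<open>Re\<close> only changes its type.\<close>

definition periodic_riesz_kernel ::
  "real^'d^'d \<Rightarrow> real \<Rightarrow> real^'d \<Rightarrow> real^'d \<Rightarrow> ereal" where
  "periodic_riesz_kernel V s x y =
     enn2ereal (\<Sum>\<^sub>\<infinity>v\<in>lattice_of V.
       \<integral>\<^sup>+t\<in>{1<..}. ennreal (exp (- (norm (x - y + v))\<^sup>2 * t)) \<partial>riesz_measure s)
     + ereal (Re (\<Sum>\<^sub>\<infinity>w\<in>dual_lattice V - {0}.
         exp (2 * of_real pi * \<i> * of_real (w \<bullet> (x - y))) *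
         of_real (LINT t:{0<..1}|riesz_measure s.
           pi powr (CARD('d) / 2) / t powr (CARD('d) / 2)
           * exp (- pi\<^sup>2 * (norm w)\<^sup>2 / t))))"

definition periodic_riesz_energy :: "real^'d^'d \<Rightarrow> real \<Rightarrow> nat \<Rightarrow> ereal" where
  "periodic_riesz_energy V s N =
     (INF x \<in> {..<N} \<rightarrow>\<^sub>E fund_domain V.
        \<Sum>(j, k) \<in> {(j, k). j < N \<and> k < N \<and> j \<noteq> k}. periodic_riesz_kernel V s (x j) (x k))"

text \<open>The kernel is infinite on the diagonal and may be negative elsewhere, so its integrals are
  taken in the extended reals. Since \<open>\<infinity> - \<infinity> = \<infinity>\<close> in \<^typ>\<open>ereal\<close>, a finite value means that the
  integrals of both the positive and the negative part are finite.\<close>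

definition ereal_integral :: "'a measure \<Rightarrow> ('a \<Rightarrow> ereal) \<Rightarrow> ereal" where
  "ereal_integral M f =
     enn2ereal (\<integral>\<^sup>+x. e2ennreal (f x) \<partial>M) - enn2ereal (\<integral>\<^sup>+x. e2ennreal (- f x) \<partial>M)"

end

theory Submission
  imports Defs "HOL-Probability.Distributions"
begin

text \<open>Write \<open>K(x, y) = A(x - y) + B(x - y)\<close> with \<open>A\<close> the lattice sum and \<open>B\<close> the dual sum. Unfolding
  the torus, \<open>\<integral> A\<close> over the fundamental domain is a Gaussian integral over the whole space with the
  claimed value \<open>C\<close>, while \<open>\<integral> B = 0\<close> since all its frequencies are nonzero. For the upper bound,
  choose the points one after the other so that each contributes at most the mean, which gives
  energy at most \<open>N(N - 1) C\<close>. For the lower bound, restrict the Laplace integral in \<open>A\<close> to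
  \<open>1 < t \<le> T\<close>, which makes \<open>A\<close> finite on the diagonal. The periodized Gaussian is a convolution
  square, so by Cauchy-Schwarz its sum over all pairs of points, diagonal included, is at least \<open>N\<^sup>2\<close>
  times its mean, and the pair sum of \<open>B\<close> is nonnegative because its coefficients are. The diagonal
  is only \<open>O(N)\<close>; finally let \<open>T \<rightarrow> \<infinity>\<close>.\<close>

subsection \<open>Volume scaling of linear maps\<close>

text \<open>The kernel has no sign, so Tonelli and mean value arguments do not apply to it directly.
  As the Fourier coefficients of \<open>B\<close> are nonnegative, \<open>B(u) + B(0)\<close> is a
  series of nonnegative terms, with \<open>1 + cos\<close> in place of \<open>cos\<close>. Adding
  the constant \<open>B(0)\<close> to the kernel therefore moves every integral to
  \<open>ennreal\<close>, and the constant is subtracted again only at the end. The truncation is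
  forced by the summand \<open>v = 0\<close>: on the diagonal it is a multiple of the integral of
  \<open>t powr (s/2 - 1)\<close> over \<open>{1<..}\<close>, which diverges. Its price is the tail
  of the integral of \<open>(pi / t) powr (d/2)\<close>, namely
  \<open>C * T powr ((s - d)/2)\<close>, which vanishes as T grows because \<open>s < d\<close>. The
  bound for the diagonal depends on T, so T is fixed before N. Averages over \<open>\<Omega>\<close>
  are plain integrals because \<open>\<Omega>\<close> has volume 1; the study of linear maps below
  serves to prove this.\<close>

lemma nn_integral_lborel_shift:
  fixes f :: "'a::euclidean_space \<Rightarrow> ennreal"
  assumes [measurable]: "f \<in> borel_measurable borel"
  shows "(\<integral>\<^sup>+x. f (x + a) \<partial>lborel) = (\<integral>\<^sup>+x. f x \<partial>lborel)"
proof -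
  have "(\<integral>\<^sup>+x. f x \<partial>lborel) = (\<integral>\<^sup>+x. f x \<partial>distr lborel borel ((+) a))"
    by (simp add: lborel_distr_plus)
  then show ?thesis
    by (simp add: nn_integral_distr add.commute)
qed

text \<open>Uniqueness of Haar measure: the integral of
  \<open>indicator C y * indicator S (x + y)\<close> over both variables is computed in two ways,
  using the invariance of Lebesgue measure for one and that of \<open>\<mu>\<close> for the other.
  Symmetry of \<open>C\<close> allows \<open>y - x\<close> to be replaced by \<open>x - y\<close>,
  after which the integral over x is again a translate of \<open>C\<close>.\<close>

lemma translation_invariant_eq_lborel:
  fixes \<mu> :: "'a::euclidean_space measure"
  assumes "sigma_finite_measure \<mu>" and sets [measurable_cong]: "sets \<mu> = sets borel"
    and inv: "\<And>a f. f \<in> borel_measurable borel \<Longrightarrow> (\<integral>\<^sup>+x. f (x + a) \<partial>\<mu>) = (\<integral>\<^sup>+x. f x \<partial>\<mu>)"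
    and C [measurable]: "C \<in> sets borel" and "emeasure lborel C = 1"
    and sym: "\<And>x. - x \<in> C \<longleftrightarrow> x \<in> C" and S [measurable]: "S \<in> sets borel"
  shows "emeasure \<mu> S = emeasure \<mu> C * emeasure lborel S"
proof -
  interpret \<mu>: sigma_finite_measure \<mu> by fact
  interpret pair_sigma_finite \<mu> "lborel :: 'a measure" ..
  have "emeasure \<mu> C * emeasure lborel S
      = (\<integral>\<^sup>+y. indicator C y * (\<integral>\<^sup>+x. indicator S (x + y) \<partial>lborel) \<partial>\<mu>)"
    by (subst nn_integral_lborel_shift) (simp_all add: nn_integral_multc sets)
  also have "\<dots> = (\<integral>\<^sup>+y. (\<integral>\<^sup>+x. indicator C y * indicator S (x + y) \<partial>lborel) \<partial>\<mu>)"
    by (simp add: nn_integral_cmult)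
  also have "\<dots> = (\<integral>\<^sup>+x. (\<integral>\<^sup>+y. indicator C y * indicator S (x + y) \<partial>\<mu>) \<partial>lborel)"
    by (rule Fubini'[symmetric]) measurable
  \<comment> \<open>Substitution of \<open>y - x\<close> for \<open>y\<close>: the only use of the
    invariance of \<open>\<mu>\<close>.\<close>
  also have "\<dots> = (\<integral>\<^sup>+x. (\<integral>\<^sup>+y. indicator C (y - x) * indicator S y \<partial>\<mu>) \<partial>lborel)"
    using inv[of "\<lambda>y. indicator C y * indicator S (x + y)" "- x" for x] by simp
  also have "\<dots> = (\<integral>\<^sup>+y. (\<integral>\<^sup>+x. indicator C (y - x) * indicator S y \<partial>lborel) \<partial>\<mu>)"
    by (rule Fubini') measurable
  also have "\<dots> = (\<integral>\<^sup>+y. (\<integral>\<^sup>+x. indicator C (x - y) \<partial>lborel) * indicator S y \<partial>\<mu>)"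
  proof -
    have "indicator C (y - x) = (indicator C (x - y) :: ennreal)" for x y
      using sym[of "x - y"] by (auto simp: indicator_def)
    then show ?thesis
      by (intro nn_integral_cong) (simp only:, simp add: nn_integral_multc)
  qed
  also have "\<dots> = (\<integral>\<^sup>+y. indicator S y \<partial>\<mu>)"
    using nn_integral_lborel_shift[of "indicator C" "- y" for y] \<open>emeasure lborel C = 1\<close>
    by (intro nn_integral_cong) simp
  finally show ?thesis
    by (simp add: sets)
qed

text \<open>The library proves \<open>measure_linear_image\<close> only for well-ordered index types, hence the
  following independent proof. The factor by which a linear bijection scales volume exists by
  uniqueness of Haar measure; it is multiplicative, so it suffices to know it on diagonal matrices:
  a transposition is an involution, and a shear is conjugate to its square by a diagonal matrix.\<close>

definition unit_cube :: "(real^'n) set" where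
  "unit_cube = cbox (\<chi> i. - 1/2) (\<chi> i. 1/2)"

text \<open>These are the conditions on \<open>C\<close> in
  \<open>translation_invariant_eq_lborel\<close>; the cube is centred at the origin to be
  symmetric.\<close>

lemma unit_cube_props:
  shows "unit_cube \<in> sets borel" "emeasure lborel (unit_cube :: (real^'n) set) = 1"
    "- x \<in> unit_cube \<longleftrightarrow> x \<in> unit_cube"
proof -
  show "unit_cube \<in> sets borel"
    by (simp add: unit_cube_def)
  have "emeasure lborel (unit_cube :: (real^'n) set) = ennreal (measure lborel (unit_cube :: (real^'n) set))"
    unfolding unit_cube_def using emeasure_lborel_cbox_finite
    by (intro emeasure_eq_ennreal_measure) (simp add: less_top)
  then show "emeasure lborel (unit_cube :: (real^'n) set) = 1"
    by (simp add: unit_cube_def content_cbox_if_cart interval_eq_empty_cart)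
  have "(\<forall>i. - (1/2) \<le> - x $ i \<and> - x $ i \<le> 1/2) \<longleftrightarrow> (\<forall>i. - (1/2) \<le> x $ i \<and> x $ i \<le> 1/2)"
    by (intro all_cong1) auto
  then show "- x \<in> unit_cube \<longleftrightarrow> x \<in> unit_cube"
    by (simp add: unit_cube_def mem_box_cart)
qed

text \<open>A preimage instead of an image: it is Borel by continuity, and its measure is that of
  the cube under the pushforward of Lebesgue measure by \<open>A\<close>.\<close>

definition volume_scale :: "real^'n^'n \<Rightarrow> ennreal" where
  "volume_scale A = emeasure lborel ((*v) A -` unit_cube)"

text \<open>The pushforward of Lebesgue measure under \<open>A\<close> is translation invariant,
  since adding \<open>a\<close> after \<open>A\<close> is adding \<open>B *v a\<close> before it,
  with \<open>B\<close> the inverse. Hence it is a multiple of Lebesgue measure.\<close>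

lemma emeasure_vimage_eq_volume_scale:
  fixes A :: "real^'n^'n"
  assumes A: "det A \<noteq> 0" and S: "S \<in> sets borel"
  shows "emeasure lborel ((*v) A -` S) = volume_scale A * emeasure lborel S"
proof -
  have meas [measurable]: "(*v) B \<in> borel_measurable borel" for B :: "real^'n^'n"
    by (intro borel_measurable_continuous_onI matrix_vector_mult_linear_continuous_on)
  define \<mu> where "\<mu> = distr lborel borel ((*v) A)"
  obtain B where B: "A ** B = mat 1" "B ** A = mat 1"
    using A by (meson invertible_def invertible_det_nz)
  have AB: "A *v (B *v x) = x" "B *v (A *v x) = x" for x
    using B by (simp_all add: matrix_vector_mul_assoc)
  have *: "emeasure \<mu> T = emeasure lborel ((*v) A -` T)" if "T \<in> sets borel" for T
    using that by (simp add: \<mu>_def emeasure_distr)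
  have "sigma_finite_measure \<mu>"
  proof (rule sigma_finite_measure.intro, intro exI conjI ballI)
    \<comment> \<open>Sets whose preimages under \<open>A\<close> are balls, hence of finite measure
      under the pushforward.\<close>
    let ?K = "range (\<lambda>n::nat. (*v) B -` cball 0 (real n))"
    show "countable ?K" "?K \<subseteq> sets \<mu>"
      by (auto simp: \<mu>_def intro!: measurable_sets_borel[OF meas])
    show "\<Union>?K = space \<mu>"
      using real_arch_simple by (auto simp: \<mu>_def)
    fix K assume "K \<in> ?K"
    then obtain n where n: "K = (*v) B -` cball 0 (real n)"
      by auto
    then have "(*v) A -` K = cball 0 (real n)" "K \<in> sets borel"
      by (auto simp: AB intro!: measurable_sets_borel[OF meas])
    then show "emeasure \<mu> K \<noteq> \<infinity>"
      using emeasure_lborel_cball_finite[of "0::real^'n" "real n"] by (simp add: * less_top)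
  qed
  moreover have "(\<integral>\<^sup>+x. f (x + a) \<partial>\<mu>) = (\<integral>\<^sup>+x. f x \<partial>\<mu>)"
    if [measurable]: "f \<in> borel_measurable borel" for f :: "real^'n \<Rightarrow> ennreal" and a
  proof -
    have "(\<integral>\<^sup>+x. f x \<partial>\<mu>) = (\<integral>\<^sup>+x. f (A *v x) \<partial>distr lborel borel ((+) (B *v a)))"
      by (simp add: \<mu>_def nn_integral_distr lborel_distr_plus)
    also have "\<dots> = (\<integral>\<^sup>+x. f (A *v x + a) \<partial>lborel)"
      by (simp add: nn_integral_distr matrix_vector_right_distrib AB add.commute)
    also have "\<dots> = (\<integral>\<^sup>+x. f (x + a) \<partial>\<mu>)"
      by (simp add: \<mu>_def nn_integral_distr)
    finally show ?thesis by simp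
  qed
  ultimately have "emeasure \<mu> S = emeasure \<mu> unit_cube * emeasure lborel S"
    by (intro translation_invariant_eq_lborel unit_cube_props S) (auto simp: \<mu>_def)
  then show ?thesis
    using S by (simp add: * unit_cube_props volume_scale_def)
qed

lemma volume_scale_mult:
  fixes A B :: "real^'n^'n"
  assumes "det A \<noteq> 0" "det B \<noteq> 0"
  shows "volume_scale (A ** B) = volume_scale A * volume_scale B"
proof -
  have "(*v) A \<in> borel_measurable borel"
    by (intro borel_measurable_continuous_onI matrix_vector_mult_linear_continuous_on)
  then have S: "(*v) A -` unit_cube \<in> sets borel"
    by (rule measurable_sets_borel) (rule unit_cube_props)
  have "volume_scale (A ** B) = emeasure lborel ((*v) B -` ((*v) A -` unit_cube))"
    unfolding volume_scale_def
    by (rule arg_cong[of _ _ "emeasure lborel"]) (auto simp: matrix_vector_mul_assoc)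
  also have "\<dots> = volume_scale B * volume_scale A"
    using emeasure_vimage_eq_volume_scale[OF assms(2) S] by (simp add: volume_scale_def)
  finally show ?thesis
    by (simp add: mult.commute)
qed

lemma volume_scale_diagonal:
  fixes A :: "real^'n^'n"
  assumes diag: "\<And>i j. i \<noteq> j \<Longrightarrow> A $ i $ j = 0" and "det A \<noteq> 0"
  shows "volume_scale A = ennreal (1 / \<bar>det A\<bar>)"
proof -
  have det: "det A = (\<Prod>i\<in>UNIV. A $ i $ i)"
    by (rule det_diagonal) (use diag in auto)
  then have nz: "A $ i $ i \<noteq> 0" for i
    using assms by auto
  have Ax: "(A *v x) $ i = A $ i $ i * x $ i" for x i
    using diag by (simp add: matrix_vector_mult_def sum.remove[of UNIV i])
  have *: "- (1/2) \<le> c * x \<and> c * x \<le> 1/2 \<longleftrightarrow> - (1 / (2 * \<bar>c\<bar>)) \<le> x \<and> x \<le> 1 / (2 * \<bar>c\<bar>)"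
    if "c \<noteq> 0" for c x :: real
    using that by (cases "c > 0") (auto simp: field_simps)
  have "(*v) A -` unit_cube
      = cbox (\<chi> i. - (1 / (2 * \<bar>A $ i $ i\<bar>))) (\<chi> i. 1 / (2 * \<bar>A $ i $ i\<bar>))" (is "_ = cbox ?a ?b")
    using * nz by (auto simp: unit_cube_def mem_box_cart Ax)
  moreover have "cbox ?a ?b \<noteq> {}"
    by (simp add: interval_eq_empty_cart not_less)
  then have "measure lborel (cbox ?a ?b) = (\<Prod>i\<in>UNIV. 1 / \<bar>A $ i $ i\<bar>)"
    by (simp add: content_cbox_cart)
  moreover have "emeasure lborel (cbox ?a ?b) = ennreal (measure lborel (cbox ?a ?b))"
    using emeasure_lborel_cbox_finite by (intro emeasure_eq_ennreal_measure) (simp add: less_top)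
  ultimately show ?thesis
    by (simp add: volume_scale_def det prod_dividef abs_prod)
qed

text \<open>The factors of \<open>A\<close> and of its inverse multiply to 1, which excludes both 0
  and infinity.\<close>

lemma volume_scale_finite_nonzero:
  fixes A :: "real^'n^'n"
  assumes "det A \<noteq> 0"
  shows "volume_scale A \<noteq> 0" "volume_scale A \<noteq> \<infinity>"
proof -
  obtain B where B: "A ** B = mat 1"
    using assms by (meson invertible_def invertible_det_nz)
  then have "det A * det B = 1"
    by (metis det_mul det_I)
  then have "det B \<noteq> 0" by auto
  have "volume_scale (mat 1 :: real^'n^'n) = 1"
    by (subst volume_scale_diagonal) (simp add: mat_def, simp_all add: det_I)
  then have "volume_scale A * volume_scale B = 1"
    using volume_scale_mult[OF assms \<open>det B \<noteq> 0\<close>] B by simp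
  then show "volume_scale A \<noteq> 0" "volume_scale A \<noteq> \<infinity>"
    by (auto simp: ennreal_top_mult split: if_splits)
qed

lemma volume_scale_eq:
  fixes A :: "real^'n^'n"
  assumes "det A \<noteq> 0"
  shows "volume_scale A = ennreal (1 / \<bar>det A\<bar>)"
proof -
  \<comment> \<open>The quotient of the actual factor by the expected one. It is multiplicative and
    positive on invertible matrices, so \<open>g A = 1\<close> has to be checked on elementary
    matrices only.\<close>
  define g where "g A = enn2real (volume_scale A) * \<bar>det A\<bar>" for A :: "real^'n^'n"
  have g_mult: "g (A ** B) = g A * g B" if "det A \<noteq> 0" "det B \<noteq> 0" for A B
    using that by (simp add: g_def volume_scale_mult enn2real_mult det_mul abs_mult)
  have g_pos: "g A > 0" if "det A \<noteq> 0" for A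
    using that volume_scale_finite_nonzero[OF that]
    by (simp add: g_def enn2real_positive_iff less_top zero_less_iff_neq_zero)
  have g_diag: "g A = 1" if "\<And>i j. i \<noteq> j \<Longrightarrow> A $ i $ j = 0" "det A \<noteq> 0" for A
    using that volume_scale_diagonal[of A] by (simp add: g_def)
  \<comment> \<open>With invertibility inside the induction predicate, the case of a zero row is
    vacuous, and in a product both factors inherit it.\<close>
  have "det A \<noteq> 0 \<longrightarrow> g A = 1"
  proof (rule induct_matrix_elementary)
    fix A B :: "real^'n^'n"
    assume "det A \<noteq> 0 \<longrightarrow> g A = 1" "det B \<noteq> 0 \<longrightarrow> g B = 1"
    then show "det (A ** B) \<noteq> 0 \<longrightarrow> g (A ** B) = 1"
      by (auto simp: g_mult det_mul)
  next
    fix A :: "real^'n^'n" and i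
    assume "row i A = 0"
    then show "det A \<noteq> 0 \<longrightarrow> g A = 1"
      using det_zero_row(2)[of i A] by simp
  next
    fix A :: "real^'n^'n"
    assume "\<And>i j. i \<noteq> j \<Longrightarrow> A $ i $ j = 0"
    then show "det A \<noteq> 0 \<longrightarrow> g A = 1"
      using g_diag by blast
  next
    fix m n :: 'n
    let ?P = "(\<chi> i j. mat 1 $ i $ Transposition.transpose m n j) :: real^'n^'n"
    have "i = Transposition.transpose m n j \<longleftrightarrow> j = Transposition.transpose m n i" for i j
      by (metis transpose_involutory)
    then have "(\<Sum>j\<in>UNIV. if i = Transposition.transpose m n j then x $ j else 0)
        = x $ Transposition.transpose m n i" for i and x :: "real^'n"
      by (simp only:) simp
    then have "?P *v x = (\<chi> i. x $ Transposition.transpose m n i)" for x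
      by (simp add: matrix_vector_mult_def mat_def vec_eq_iff if_distrib[of "\<lambda>u. u * _"] cong: if_cong)
    then have PP: "?P ** ?P = mat 1"
      by (simp add: matrix_eq matrix_vector_mul_assoc[symmetric])
    show "det ?P \<noteq> 0 \<longrightarrow> g ?P = 1"
    proof
      assume P: "det ?P \<noteq> 0"
      then have "g ?P * g ?P = g (mat 1)"
        by (simp add: g_mult[symmetric] PP)
      also have "\<dots> = 1"
        by (rule g_diag) (simp add: mat_def, simp add: det_I)
      finally show "g ?P = 1"
        using g_pos[OF P] by (simp add: square_eq_1_iff)
    qed
  next
    fix m n :: 'n and c
    assume idplus: "m \<noteq> n"
    define E :: "real \<Rightarrow> real^'n^'n"
      where "E c = (\<chi> i j. if i = m \<and> j = n then c else of_bool (i = j))" for c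
    have E: "E c *v x = (\<chi> i. if i = m then x $ m + c * x $ n else x $ i)" for c x
    proof -
      have "(\<Sum>j\<in>UNIV. (if i = m \<and> j = n then c else of_bool (i = j)) * x $ j)
          = (\<Sum>j\<in>UNIV. (if i = j then x $ j else 0) + (if j = n then if i = m then c * x $ j else 0 else 0))" for i
        using idplus by (intro sum.cong) auto
      then show ?thesis
        by (simp add: E_def matrix_vector_mult_def vec_eq_iff sum.distrib)
    qed
    define D :: "real^'n^'n" where "D = (\<chi> i j. if i = j then if i = m then 2 else 1 else 0)"
    have D: "D *v x = (\<chi> i. if i = m then 2 * x $ i else x $ i)" for x
      by (simp add: D_def matrix_vector_mult_def vec_eq_iff if_distrib[of "\<lambda>u. u * _"] cong: if_cong)
    have detD: "det D \<noteq> 0"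
      by (subst det_diagonal) (auto simp: D_def)
    \<comment> \<open>The first identity gives \<open>g (E c) * g (E c) = g (E (2 * c))\<close>, the
      second with \<open>g D = 1\<close> gives \<open>g (E c) = g (E (2 * c))\<close>. Cancelling
      the positive number \<open>g (E c)\<close> leaves 1.\<close>
    have "E c ** E c = E (2 * c)" "D ** E c = E (2 * c) ** D"
      using idplus by (auto simp: matrix_eq matrix_vector_mul_assoc[symmetric] E D vec_eq_iff algebra_simps)
    moreover have "g D = 1"
      using detD by (intro g_diag) (auto simp: D_def)
    moreover have "det (E c) \<noteq> 0 \<Longrightarrow> det (E (2 * c)) \<noteq> 0"
      by (metis calculation(1) det_mul mult_eq_0_iff)
    ultimately have "det (E c) \<noteq> 0 \<longrightarrow> g (E c) = 1"
      using g_mult detD g_pos[of "E c"] by (metis less_irrefl mult_1 mult_1_right mult_cancel_left)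
    then show "det (\<chi> i j. if i = m \<and> j = n then c else of_bool (i = j)) \<noteq> 0 \<longrightarrow>
        g (\<chi> i j. if i = m \<and> j = n then c else of_bool (i = j)) = 1"
      by (simp add: E_def)
  qed
  then have "enn2real (volume_scale A) = 1 / \<bar>det A\<bar>"
    using assms by (simp add: g_def field_simps)
  then show ?thesis
    using volume_scale_finite_nonzero[OF assms] by (metis ennreal_enn2real_if infinity_ennreal_def)
qed

subsection \<open>Sums over the lattice and tilings\<close>

lemma nn_integral_count_space_from_nat_into:
  assumes "countable I" "infinite I"
  shows "(\<integral>\<^sup>+i. f i \<partial>count_space I) = (\<Sum>n. f (from_nat_into I n))"
  by (simp add: nn_integral_bij_count_space[symmetric, OF bij_betw_from_nat_into[OF assms]]
      nn_integral_count_space_nat)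

lemma borel_measurable_nn_integral_count_space:
  assumes "countable I" and [measurable]: "\<And>i. i \<in> I \<Longrightarrow> f i \<in> borel_measurable M"
  shows "(\<lambda>x. \<integral>\<^sup>+i. f i x \<partial>count_space I) \<in> borel_measurable M"
proof (cases "finite I")
  case True
  then show ?thesis
    by (simp add: nn_integral_count_space_finite)
next
  case False
  then have "from_nat_into I n \<in> I" for n
    by (intro from_nat_into) auto
  then show ?thesis
    by (simp add: nn_integral_count_space_from_nat_into[OF assms(1) False])
qed

text \<open>Brings the lattice sum of the kernel into the form of an integral, for which Tonelli and
  reindexing along bijections are at hand.\<close>

lemma infsum_ennreal_eq_nn_integral:
  fixes f :: "'a \<Rightarrow> ennreal"
  assumes "countable A"
  shows "(\<Sum>\<^sub>\<infinity>x\<in>A. f x) = (\<integral>\<^sup>+x. f x \<partial>count_space A)"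
proof (cases "finite A")
  case True
  then show ?thesis
    by (simp add: nn_integral_count_space_finite)
next
  case False
  note bij = bij_betw_from_nat_into[OF assms False]
  have "(\<Sum>\<^sub>\<infinity>x\<in>A. f x) = (\<Sum>\<^sub>\<infinity>n. f (from_nat_into A n))"
    by (rule infsum_reindex_bij_betw[OF bij, symmetric])
  also have "\<dots> = (\<Sum>n. f (from_nat_into A n))"
  proof -
    have "((\<lambda>n. f (from_nat_into A n)) has_sum (\<Sum>\<^sub>\<infinity>n. f (from_nat_into A n))) UNIV"
      by (intro has_sum_infsum nonneg_summable_on_complete) simp
    then show ?thesis
      using has_sum_imp_sums sums_unique by blast
  qed
  finally show ?thesis
    by (simp add: nn_integral_count_space_from_nat_into[OF assms False])
qed

lemma ennreal_infsum_eq_nn_integral: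
  fixes f :: "'a \<Rightarrow> real"
  assumes "f summable_on A" "\<And>x. x \<in> A \<Longrightarrow> 0 \<le> f x"
  shows "ennreal (\<Sum>\<^sub>\<infinity>x\<in>A. f x) = (\<integral>\<^sup>+x. ennreal (f x) \<partial>count_space A)"
proof -
  have f: "Infinite_Sum.abs_summable_on f A"
    using assms(1) summable_on_iff_abs_summable_on_real by blast
  then have f': "Infinite_Set_Sum.abs_summable_on f A"
    by (simp only: abs_summable_equivalent)
  then show ?thesis
    using assms(2) by (simp only: nn_integral_conv_infsetsum infsetsum_infsum[OF f'])
qed

lemma summable_on_nn_integral:
  fixes f :: "'a \<Rightarrow> real"
  assumes "(\<integral>\<^sup>+x. ennreal (f x) \<partial>count_space A) < \<infinity>" "\<And>x. x \<in> A \<Longrightarrow> 0 \<le> f x"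
  shows "f summable_on A"
proof -
  have "integrable (count_space A) f"
    using assms by (intro integrableI_nonneg) (auto simp: AE_count_space)
  then have "Infinite_Sum.abs_summable_on f A"
    unfolding abs_summable_equivalent abs_summable_on_def .
  then show ?thesis
    by (rule abs_summable_summable)
qed

section \<open>Gaussian integrals\<close>

lemma nn_integral_gaussian_real:
  assumes "0 < c"
  shows "(\<integral>\<^sup>+x. ennreal (exp (- c * x\<^sup>2)) \<partial>(lborel :: real measure)) = ennreal (sqrt (pi / c))"
proof -
  \<comment> \<open>The standard deviation for which the normal density has exponent
    \<open>- c * x\<^sup>2\<close>.\<close>
  define \<sigma> where "\<sigma> = 1 / sqrt (2 * c)"
  have \<sigma>: "2 * \<sigma>\<^sup>2 = 1 / c"
    using assms by (simp add: \<sigma>_def power_divide)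
  have "2 * pi * \<sigma>\<^sup>2 = pi / c"
    using arg_cong[OF \<sigma>, of "\<lambda>x. pi * x"] by simp
  then have "exp (- c * x\<^sup>2) = sqrt (pi / c) * normal_density 0 \<sigma> x" for x
    using assms \<sigma> by (simp add: normal_density_def mult.commute)
  then have "(\<integral>\<^sup>+x. ennreal (exp (- c * x\<^sup>2)) \<partial>(lborel :: real measure))
      = ennreal (sqrt (pi / c)) * (\<integral>\<^sup>+x. ennreal (normal_density 0 \<sigma> x) \<partial>lborel)"
    using assms by (simp add: ennreal_mult nn_integral_cmult)
  also have "(\<integral>\<^sup>+x. ennreal (normal_density 0 \<sigma> x) \<partial>lborel) = 1"
    using assms by (subst nn_integral_eq_integral) (auto simp: \<sigma>_def)
  finally show ?thesis by simp
qed

lemma nn_integral_gaussian: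
  assumes "0 < c"
  shows "(\<integral>\<^sup>+x. ennreal (exp (- c * (norm x)\<^sup>2)) \<partial>(lborel :: (real^'d) measure))
    = ennreal ((pi / c) powr (CARD('d) / 2))"
proof -
  have "exp (- c * (norm x)\<^sup>2) = (\<Prod>b\<in>Basis. exp (- c * (x \<bullet> b)\<^sup>2))" for x :: "real^'d"
    by (simp add: exp_sum[symmetric] sum_distrib_left[symmetric] sum_negf norm_eq_sqrt_inner
        euclidean_inner[of x x] power2_eq_square sum_nonneg)
  then have "(\<integral>\<^sup>+x. ennreal (exp (- c * (norm x)\<^sup>2)) \<partial>(lborel :: (real^'d) measure))
      = (\<integral>\<^sup>+x. (\<Prod>b\<in>Basis. ennreal (exp (- c * (x \<bullet> b)\<^sup>2))) \<partial>(lborel :: (real^'d) measure))"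
    by (simp add: prod_ennreal)
  also have "\<dots> = ennreal (sqrt (pi / c)) ^ CARD('d)"
    using nn_integral_gaussian_real[OF assms]
    by (subst nn_integral_lborel_prod) auto
  also have "\<dots> = ennreal (sqrt (pi / c) ^ CARD('d))"
    using assms by (simp add: ennreal_power)
  also have "sqrt (pi / c) ^ CARD('d) = (pi / c) powr (CARD('d) / 2)"
    using assms by (simp add: powr_half_sqrt[symmetric] powr_powr flip: powr_realpow)
  finally show ?thesis .
qed

section \<open>The lattice and its fundamental domain\<close>

locale unimodular_basis =
  fixes V :: "real^'d^'d"
  assumes det_V: "det V = 1"
begin

abbreviation L where "L \<equiv> lattice_of V"
abbreviation \<Omega> where "\<Omega> \<equiv> fund_domain V"

lemma invertible_V: "invertible V"
  by (simp add: invertible_det_nz det_V)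

lemma inv_V: "matrix_inv V *v (V *v x) = x" "V *v (matrix_inv V *v x) = x"
  using someI_ex[OF invertible_V[unfolded invertible_def]]
  by (simp_all add: matrix_vector_mul_assoc flip: matrix_inv_def)

lemma lattice_eq_image: "L = (*v) V ` {k. \<forall>i. k $ i \<in> \<int>}"
  by (auto simp: lattice_of_def)

lemma fund_domain_eq_image: "\<Omega> = (*v) V ` {a. \<forall>i. 0 \<le> a $ i \<and> a $ i < 1}"
proof (intro subset_antisym subsetI)
  fix x assume "x \<in> \<Omega>"
  then obtain \<alpha> where \<alpha>: "\<forall>j. 0 \<le> \<alpha> j \<and> \<alpha> j < 1" "x = (\<Sum>j\<in>UNIV. \<alpha> j *\<^sub>R column j V)"
    by (auto simp: fund_domain_def)
  then have "x = V *v (\<chi> j. \<alpha> j)"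
    by (simp add: matrix_mult_sum scalar_mult_eq_scaleR)
  with \<alpha> show "x \<in> (*v) V ` {a. \<forall>i. 0 \<le> a $ i \<and> a $ i < 1}"
    by force
qed (auto simp: fund_domain_def matrix_mult_sum scalar_mult_eq_scaleR)

lemma countable_lattice: "countable L"
proof -
  have "{k::real^'d. \<forall>i. k $ i \<in> \<int>} \<subseteq> range (\<lambda>g::'d \<Rightarrow> int. \<chi> i. of_int (g i))"
  proof
    fix k :: "real^'d" assume "k \<in> {k. \<forall>i. k $ i \<in> \<int>}"
    then have "\<forall>i. \<exists>n. k $ i = of_int n"
      by (auto simp: Ints_def)
    then obtain g where "\<forall>i. k $ i = of_int (g i)"
      by metis
    then show "k \<in> range (\<lambda>g::'d \<Rightarrow> int. \<chi> i. of_int (g i))"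
      by (auto simp: vec_eq_iff intro!: image_eqI[of _ _ g])
  qed
  then show ?thesis
    unfolding lattice_eq_image by (intro countable_image) (rule countable_subset, auto)
qed

lemma lattice_add: "v \<in> L \<Longrightarrow> w \<in> L \<Longrightarrow> v + w \<in> L"
  unfolding lattice_of_def by (force simp flip: matrix_vector_right_distrib)

lemma lattice_minus_iff: "- v \<in> L \<longleftrightarrow> v \<in> L"
proof -
  have "- v \<in> L" if v: "v \<in> L" for v
  proof -
    obtain k where "\<forall>i. k $ i \<in> \<int>" "v = V *v k"
      using v by (auto simp: lattice_of_def)
    then have "\<forall>i. (- k) $ i \<in> \<int>" "- v = V *v (- k)"
      by (simp_all add: linear_neg[OF matrix_vector_mul_linear])
    then show ?thesis
      unfolding lattice_of_def by blast
  qed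
  from this[of v] this[of "- v"] show ?thesis by auto
qed

lemma bij_lattice_shift: "w \<in> L \<Longrightarrow> bij_betw (\<lambda>v. v + w) L L"
  by (rule bij_betwI[of _ _ _ "\<lambda>v. v - w"])
    (auto intro: lattice_add lattice_add[of _ "- w", simplified] simp: lattice_minus_iff)

lemma bij_lattice_uminus: "bij_betw uminus L L"
  by (rule bij_betwI[of _ _ _ uminus]) (auto simp: lattice_minus_iff)

text \<open>In coordinates of the basis this is the splitting of a real number into its floor and a
  fractional part in \<open>{0..<1}\<close>. It expresses that the lattice translates of
  \<open>\<Omega>\<close> tile the space.\<close>

lemma ex1_lattice_translate: "\<exists>!v. v \<in> L \<and> x - v \<in> \<Omega>"
proof (rule ex1I)
  define a where "a = matrix_inv V *v x"
  define k :: "real^'d" where "k = (\<chi> i. of_int \<lfloor>a $ i\<rfloor>)"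
  have x: "x = V *v a"
    by (simp add: a_def inv_V)
  have *: "x - V *v k = V *v (a - k)"
    by (simp add: x matrix_vector_mult_diff_distrib)
  have "V *v k \<in> L"
    by (auto simp: lattice_eq_image k_def)
  moreover have "V *v (a - k) \<in> \<Omega>"
    unfolding fund_domain_eq_image k_def
    by (intro imageI) (auto, linarith+)
  ultimately show "V *v k \<in> L \<and> x - V *v k \<in> \<Omega>"
    by (simp add: *)
  fix v assume "v \<in> L \<and> x - v \<in> \<Omega>"
  then obtain l b where l: "v = V *v l" "\<forall>i. l $ i \<in> \<int>"
    and b: "x - v = V *v b" "\<forall>i. 0 \<le> b $ i \<and> b $ i < 1"
    by (auto simp: lattice_eq_image fund_domain_eq_image)
  have "V *v (a - l) = V *v b"
    using b l by (simp add: x matrix_vector_mult_diff_distrib)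
  then have ab: "a - l = b"
    by (metis inv_V(1))
  have "l $ i = of_int \<lfloor>a $ i\<rfloor>" for i
  proof -
    obtain n where n: "l $ i = of_int n"
      using l(2) by (auto simp: Ints_def)
    have "a $ i = of_int n + b $ i"
      using arg_cong[OF ab, of "\<lambda>v. v $ i"] n by simp
    moreover have "0 \<le> b $ i" "b $ i < 1"
      using b(2) by auto
    ultimately have "\<lfloor>a $ i\<rfloor> = n"
      by linarith
    then show ?thesis
      by (simp add: n)
  qed
  then show "v = V *v k"
    unfolding l(1) k_def by (intro arg_cong[of _ _ "(*v) V"]) (simp add: vec_eq_iff)
qed

lemma fund_domain_sets [measurable]: "\<Omega> \<in> sets borel"
proof -
  have "\<Omega> = matrix_vector_mult (matrix_inv V) -` {a. \<forall>i. 0 \<le> a $ i \<and> a $ i < 1}"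
    unfolding fund_domain_eq_image using inv_V by (auto intro!: image_eqI)
  moreover have "matrix_vector_mult (matrix_inv V) \<in> borel_measurable borel"
    by (intro borel_measurable_continuous_onI matrix_vector_mult_linear_continuous_on)
  moreover have "{a::real^'d. \<forall>i. 0 \<le> a $ i \<and> a $ i < 1} \<in> sets borel"
    by measurable
  ultimately show ?thesis
    using measurable_sets[of "matrix_vector_mult (matrix_inv V)" borel borel] by force
qed

lemma bounded_fund_domain: "bounded \<Omega>"
proof -
  have "{a::real^'d. \<forall>i. 0 \<le> a $ i \<and> a $ i < 1} \<subseteq> cbox 0 1"
    by (auto simp: mem_box_cart less_imp_le)
  then have "bounded {a::real^'d. \<forall>i. 0 \<le> a $ i \<and> a $ i < 1}"
    using bounded_subset bounded_cbox by blast
  then show ?thesis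
    unfolding fund_domain_eq_image
    by (intro bounded_linear_image) (auto intro: matrix_vector_mul_bounded_linear)
qed

text \<open>The preimage of \<open>\<Omega>\<close> under \<open>V\<close> is the half-open unit
  cube, squeezed between the open and the closed one, and the scaling factor of \<open>V\<close> is
  1.\<close>

lemma emeasure_fund_domain: "emeasure lborel \<Omega> = 1"
proof -
  define C :: "(real^'d) set" where "C = {a. \<forall>i. 0 \<le> a $ i \<and> a $ i < 1}"
  have "box 0 1 \<subseteq> C" "C \<subseteq> cbox 0 1"
    by (auto simp: C_def mem_box_cart less_imp_le)
  moreover have "C \<in> sets borel"
    unfolding C_def by measurable
  ultimately have "emeasure lborel (box 0 (1::real^'d)) \<le> emeasure lborel C"
      "emeasure lborel C \<le> emeasure lborel (cbox 0 (1::real^'d))"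
    by (auto intro!: emeasure_mono)
  moreover have "emeasure lborel (cbox 0 (1::real^'d)) = 1"
    by (subst emeasure_lborel_cbox_eq) (auto simp: Basis_vec_def inner_axis intro!: prod.neutral)
  moreover have "emeasure lborel (box 0 (1::real^'d)) = 1"
    by (subst emeasure_lborel_box_eq) (auto simp: Basis_vec_def inner_axis intro!: prod.neutral)
  ultimately have "emeasure lborel C = 1"
    by simp
  moreover have "(*v) V -` \<Omega> = C"
    unfolding fund_domain_eq_image C_def by (auto dest: arg_cong[of _ _ "(*v) (matrix_inv V)"] simp: inv_V)
  ultimately show ?thesis
    using emeasure_vimage_eq_volume_scale[of V \<Omega>] volume_scale_eq[of V] fund_domain_sets
    by (simp add: det_V)
qed

section \<open>Unfolding integrals over the torus\<close>

lemma nn_integral_indicator_lattice: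
  "(\<integral>\<^sup>+v. indicator \<Omega> (x - v) \<partial>count_space L) = (1::ennreal)"
proof -
  obtain v where v: "v \<in> L" "x - v \<in> \<Omega>" "\<And>w. w \<in> L \<Longrightarrow> x - w \<in> \<Omega> \<Longrightarrow> w = v"
    using ex1_lattice_translate by metis
  have "(\<integral>\<^sup>+v. indicator \<Omega> (x - v) \<partial>count_space L) = (\<Sum>w\<in>{v}. indicator \<Omega> (x - w) :: ennreal)"
  proof (rule nn_integral_count_space')
    show "finite {v}" "{v} \<subseteq> L"
      using v(1) by simp_all
    fix w assume "w \<in> L" "w \<notin> {v}"
    then have "x - w \<notin> \<Omega>"
      using v(3) by blast
    then show "indicator \<Omega> (x - w) = (0::ennreal)"
      by (rule indicator_simps(2))
  qed
  also have "\<dots> = 1"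
    using v(2) by (simp only: sum.insert sum.empty finite.emptyI empty_iff simp_thms indicator_simps(1) add_0_right)
  finally show ?thesis .
qed

lemma set_nn_integral_fund_domain_translate:
  assumes [measurable]: "f \<in> borel_measurable borel"
  shows "(\<integral>\<^sup>+u\<in>\<Omega>. f (u + a) \<partial>lborel) = (\<integral>\<^sup>+x. f x * indicator \<Omega> (x - a) \<partial>lborel)"
proof -
  have "(\<lambda>x. f x * indicator \<Omega> (x - a)) \<in> borel_measurable borel"
    by measurable
  from nn_integral_lborel_shift[OF this, of a] show ?thesis
    by (simp only: add_diff_cancel_right')
qed

text \<open>After Tonelli and a translation, each lattice vector contributes the integral of
  \<open>f\<close> over one translate of \<open>\<Omega>\<close>; the tiling, in the form of a
  partition of unity, puts these pieces together.\<close>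

lemma nn_integral_periodization:
  assumes [measurable]: "f \<in> borel_measurable borel"
  shows "(\<integral>\<^sup>+u\<in>\<Omega>. (\<integral>\<^sup>+v. f (u + v) \<partial>count_space L) \<partial>lborel) = (\<integral>\<^sup>+x. f x \<partial>lborel)"
proof -
  have "(\<integral>\<^sup>+u\<in>\<Omega>. (\<integral>\<^sup>+v. f (u + v) \<partial>count_space L) \<partial>lborel)
      = (\<integral>\<^sup>+u. (\<integral>\<^sup>+v. f (u + v) * indicator \<Omega> u \<partial>count_space L) \<partial>lborel)"
    by (intro nn_integral_cong nn_integral_multc[symmetric]) simp
  also have "\<dots> = (\<integral>\<^sup>+v. (\<integral>\<^sup>+u\<in>\<Omega>. f (u + v) \<partial>lborel) \<partial>count_space L)"
    by (rule nn_integral_count_space_nn_integral[OF countable_lattice]) measurable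
  also have "\<dots> = (\<integral>\<^sup>+v. (\<integral>\<^sup>+x. f x * indicator \<Omega> (x - v) \<partial>lborel) \<partial>count_space L)"
    by (simp only: set_nn_integral_fund_domain_translate[OF assms])
  also have "\<dots> = (\<integral>\<^sup>+x. (\<integral>\<^sup>+v. f x * indicator \<Omega> (x - v) \<partial>count_space L) \<partial>lborel)"
    by (rule nn_integral_count_space_nn_integral[OF countable_lattice, symmetric]) measurable
  also have "\<dots> = (\<integral>\<^sup>+x. f x * (\<integral>\<^sup>+v. indicator \<Omega> (x - v) \<partial>count_space L) \<partial>lborel)"
    by (intro nn_integral_cong nn_integral_cmult) simp
  finally show ?thesis
    by (simp only: nn_integral_indicator_lattice mult_1_right)
qed

text \<open>Integrate \<open>f\<close> over the translate of \<open>\<Omega>\<close> by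
  \<open>a\<close> and fold this back into \<open>\<Omega>\<close> with
  \<open>nn_integral_periodization\<close>. By periodicity \<open>f\<close> leaves the lattice sum,
  and what remains is the partition of unity.\<close>

lemma nn_integral_fund_domain_shift:
  assumes [measurable]: "f \<in> borel_measurable borel"
    and per: "\<And>x v. v \<in> L \<Longrightarrow> f (x + v) = f x"
  shows "(\<integral>\<^sup>+u\<in>\<Omega>. f (u + a) \<partial>lborel) = (\<integral>\<^sup>+u\<in>\<Omega>. f u \<partial>lborel)"
proof -
  have *: "(\<integral>\<^sup>+v. indicator \<Omega> (u + v - a) \<partial>count_space L) = (1::ennreal)" for u
  proof -
    \<comment> \<open>The partition of unity is stated with \<open>x - v\<close>; the sign is
      absorbed by the symmetry of the lattice.\<close>
    have "u + v - a = u - a - - v" for v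
      by simp
    then show ?thesis
      by (simp only: nn_integral_bij_count_space[OF bij_lattice_uminus, of "\<lambda>v. indicator \<Omega> (u - a - v)"]
          nn_integral_indicator_lattice)
  qed
  have "(\<integral>\<^sup>+u\<in>\<Omega>. f (u + a) \<partial>lborel) = (\<integral>\<^sup>+x. f x * indicator \<Omega> (x - a) \<partial>lborel)"
    by (rule set_nn_integral_fund_domain_translate) fact
  also have "\<dots> = (\<integral>\<^sup>+u\<in>\<Omega>. (\<integral>\<^sup>+v. f (u + v) * indicator \<Omega> (u + v - a) \<partial>count_space L) \<partial>lborel)"
    by (rule nn_integral_periodization[symmetric]) measurable
  also have "\<dots> = (\<integral>\<^sup>+u\<in>\<Omega>. (\<integral>\<^sup>+v. f u * indicator \<Omega> (u + v - a) \<partial>count_space L) \<partial>lborel)"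
    by (intro nn_integral_cong arg_cong2[of _ _ _ _ "(*)"] refl) (simp add: per)
  also have "\<dots> = (\<integral>\<^sup>+u\<in>\<Omega>. f u * (\<integral>\<^sup>+v. indicator \<Omega> (u + v - a) \<partial>count_space L) \<partial>lborel)"
    by (intro nn_integral_cong arg_cong2[of _ _ _ _ "(*)"] refl nn_integral_cmult) simp
  finally show ?thesis
    by (simp only: * mult_1_right)
qed

end

subsection \<open>The dual sum\<close>

lemma has_sum_sum:
  fixes f :: "'a \<Rightarrow> 'b \<Rightarrow> 'c::topological_comm_monoid_add"
  assumes "finite J" "\<And>j. j \<in> J \<Longrightarrow> (f j has_sum S j) A"
  shows "((\<lambda>x. \<Sum>j\<in>J. f j x) has_sum (\<Sum>j\<in>J. S j)) A"
  using assms by (induction J rule: finite_induct) (auto intro: has_sum_add)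

text \<open>From \<open>(1 + y / n) ^ n \<le> exp y\<close> at \<open>y = q * x\<close>. It serves
  to absorb powers of \<open>1 / t\<close> into the exponential factor of the dual
  coefficients.\<close>

lemma power_le_exp_mult:
  assumes "0 < q" "0 < n" "0 \<le> x"
  shows "x ^ n \<le> (real n / q) ^ n * exp (q * x)"
proof -
  have "(q * x / n) ^ n \<le> (1 + q * x / n) ^ n"
    using assms by (intro power_mono) auto
  also have "\<dots> \<le> exp (q * x)"
    using assms by (intro exp_ge_one_plus_x_over_n_power_n) (auto intro: order_trans[of _ 0])
  finally have "(n / q) ^ n * (q * x / n) ^ n \<le> (n / q) ^ n * exp (q * x)"
    using assms by (intro mult_left_mono) auto
  moreover have "(n / q) ^ n * (q * x / n) ^ n = x ^ n"
    using assms by (simp flip: power_mult_distrib)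
  ultimately show ?thesis by simp
qed

text \<open>The coefficient of the frequency \<open>w\<close> in the dual sum, written as in the
  kernel so that it can be folded there.\<close>

definition riesz_coeff :: "real \<Rightarrow> real^'d \<Rightarrow> real" where
  "riesz_coeff s w = (LINT t:{0<..1}|riesz_measure s.
     pi powr (CARD('d) / 2) / t powr (CARD('d) / 2) * exp (- pi\<^sup>2 * (norm w)\<^sup>2 / t))"

lemma riesz_coeff_nonneg: "0 \<le> riesz_coeff s w"
  unfolding riesz_coeff_def set_lebesgue_integral_def
  by (intro integral_nonneg_AE AE_I2) (auto simp: indicator_def)

text \<open>In terms of \<open>x = 1 / t \<ge> 1\<close> the integrand is a power of x times
  \<open>exp (- pi\<^sup>2 * (norm w)\<^sup>2 * x)\<close>. One half of the exponent absorbs the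
  power, uniformly for \<open>norm w \<ge> m\<close>; the other half is largest at
  \<open>x = 1\<close> and leaves a Gaussian in \<open>w\<close>.\<close>

lemma riesz_coeff_le:
  assumes "0 < s" "0 < m"
  obtains M where "0 \<le> M"
    "\<And>w :: real^'d. m \<le> norm w \<Longrightarrow> riesz_coeff s w \<le> M * exp (- (pi\<^sup>2 / 2) * (norm w)\<^sup>2)"
proof -
  define h where "h = real CARD('d) / 2"
  \<comment> \<open>A positive integer exponent dominating the exponent \<open>h + 1 - s / 2\<close>
    of \<open>1 / t\<close> in the integrand.\<close>
  define n where "n = Suc (nat \<lceil>h + 1\<rceil>)"
  have n: "h + 1 - s / 2 \<le> real n" "0 < n"
    using assms by (auto simp: n_def) linarith
  \<comment> \<open>Half of the slowest decay rate \<open>pi\<^sup>2 * m\<^sup>2\<close> that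
    occurs.\<close>
  define q where "q = pi\<^sup>2 * m\<^sup>2 / 2"
  have q: "0 < q"
    using assms by (simp add: q_def)
  have G: "0 < Gamma (s / 2)"
    using assms by (intro Gamma_real_pos) simp
  define M where "M = pi powr h / Gamma (s / 2) * (real n / q) ^ n"
  have M: "0 \<le> M"
    using G q by (auto simp: M_def intro!: mult_nonneg_nonneg)
  have bound: "t powr (s / 2 - 1) / Gamma (s / 2) * (pi powr h / t powr h * exp (- pi\<^sup>2 * (norm w)\<^sup>2 / t))
      \<le> M * exp (- (pi\<^sup>2 / 2) * (norm w)\<^sup>2)" if t: "0 < t" "t \<le> 1" and w: "m \<le> norm w" for t and w :: "real^'d"
  proof -
    define x where "x = 1 / t"
    have x: "1 \<le> x"
      using t by (simp add: x_def)
    have w2: "m\<^sup>2 \<le> (norm w)\<^sup>2"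
      using w assms by (intro power_mono) auto
    have "t powr (s / 2 - 1) / t powr h = x powr (h + 1 - s / 2)"
    proof -
      have "x = t powr (- 1)"
        using t by (simp add: x_def powr_minus_divide)
      then have "x powr (h + 1 - s / 2) = t powr (s / 2 - 1 - h)"
        by (simp only: powr_powr) (simp add: algebra_simps)
      then show ?thesis
        by (simp add: powr_diff)
    qed
    also have "\<dots> \<le> x powr real n"
      using x n by (intro powr_mono) auto
    also have "\<dots> = x ^ n"
      using x by (simp add: powr_realpow)
    also have "\<dots> \<le> (real n / q) ^ n * exp (q * x)"
      using x by (intro power_le_exp_mult q n) auto
    finally have 1: "t powr (s / 2 - 1) / t powr h \<le> (real n / q) ^ n * exp (q * x)" .
    have "q * x \<le> pi\<^sup>2 * (norm w)\<^sup>2 / 2 * x"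
      using w2 x by (auto simp: q_def intro!: mult_right_mono)
    moreover have "pi\<^sup>2 * (norm w)\<^sup>2 / 2 * 1 \<le> pi\<^sup>2 * (norm w)\<^sup>2 / 2 * x"
      using x by (intro mult_left_mono) auto
    ultimately have 2: "exp (q * x) * exp (- pi\<^sup>2 * (norm w)\<^sup>2 * x) \<le> exp (- (pi\<^sup>2 / 2) * (norm w)\<^sup>2)"
      unfolding exp_add[symmetric] exp_le_cancel_iff mult_minus_left by (simp only: times_divide_eq_left mult_1_right)
    have "t powr (s / 2 - 1) / Gamma (s / 2) * (pi powr h / t powr h * exp (- pi\<^sup>2 * (norm w)\<^sup>2 / t))
        = pi powr h / Gamma (s / 2) * ((t powr (s / 2 - 1) / t powr h) * exp (- pi\<^sup>2 * (norm w)\<^sup>2 * x))"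
      by (simp add: x_def field_simps)
    also have "\<dots> \<le> pi powr h / Gamma (s / 2) * (((real n / q) ^ n * exp (q * x)) * exp (- pi\<^sup>2 * (norm w)\<^sup>2 * x))"
      using 1 G by (intro mult_left_mono mult_right_mono) auto
    also have "\<dots> = M * (exp (q * x) * exp (- pi\<^sup>2 * (norm w)\<^sup>2 * x))"
      by (simp add: M_def)
    also have "\<dots> \<le> M * exp (- (pi\<^sup>2 / 2) * (norm w)\<^sup>2)"
      using 2 M by (rule mult_left_mono)
    finally show ?thesis .
  qed
  show thesis
  proof (rule that[OF M])
    fix w :: "real^'d" assume w: "m \<le> norm w"
    let ?e = "M * exp (- (pi\<^sup>2 / 2) * (norm w)\<^sup>2)"
    have "riesz_coeff s w = (\<integral>t. indicator {0<..} t * (t powr (s/2 - 1) / Gamma (s/2)) *\<^sub>R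
        (indicator {0<..1} t *\<^sub>R (pi powr h / t powr h * exp (- pi\<^sup>2 * (norm w)\<^sup>2 / t))) \<partial>lborel)"
      unfolding riesz_coeff_def set_lebesgue_integral_def riesz_measure_def h_def
      using G by (subst integral_density) (auto intro!: AE_I2 simp: less_imp_le mult.assoc)
    also have "\<dots> \<le> (\<integral>t. indicator {0<..1} t * ?e \<partial>(lborel :: real measure))"
    \<comment> \<open>Integrability is shown for the majorant alone: a Bochner integral that does
      not exist has value 0, which is below the nonnegative bound.\<close>
    proof (rule integral_mono')
      show "integrable lborel (\<lambda>t::real. indicator {0<..1} t * ?e)"
        by (intro integrable_mult_left integrable_real_indicator) auto
    next
      fix t :: real
      show "indicator {0<..} t * (t powr (s/2 - 1) / Gamma (s/2)) *\<^sub>R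
        (indicator {0<..1} t *\<^sub>R (pi powr h / t powr h * exp (- pi\<^sup>2 * (norm w)\<^sup>2 / t))) \<le> indicator {0<..1} t * ?e"
        using bound[of t w] w by (cases "0 < t \<and> t \<le> 1") (auto simp: indicator_def)
      show "0 \<le> indicator {0<..1} t * ?e"
        using M by simp
    qed
    also have "\<dots> = ?e"
      by simp
    finally show "riesz_coeff s w \<le> ?e" .
  qed
qed

context unimodular_basis
begin

text \<open>By the parallelogram law, each summand is at most a constant times the wider Gaussian,
  of rate \<open>c / 2\<close>, at \<open>u + v\<close>, for every \<open>u\<close> in the bounded
  set \<open>\<Omega>\<close>. Averaging over \<open>u\<close> and unfolding bounds the lattice sum
  by a Gaussian integral over the space.\<close>

lemma nn_integral_gaussian_lattice_finite:
  assumes "0 < c"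
  shows "(\<integral>\<^sup>+v. ennreal (exp (- c * (norm v)\<^sup>2)) \<partial>count_space L) < \<infinity>"
proof -
  obtain R where R: "\<And>u. u \<in> \<Omega> \<Longrightarrow> norm u \<le> R"
    using bounded_fund_domain by (auto simp: bounded_iff)
  define S where "S = (\<integral>\<^sup>+v. ennreal (exp (- c * (norm v)\<^sup>2)) \<partial>count_space L)"
  let ?g = "\<lambda>x::real^'d. ennreal (exp (- (c / 2) * (norm x)\<^sup>2))"
  have le: "ennreal (exp (- c * R\<^sup>2)) * ennreal (exp (- c * (norm v)\<^sup>2)) \<le> ?g (u + v)"
    if u: "u \<in> \<Omega>" for u v
  proof -
    have "(norm (u + v))\<^sup>2 \<le> (norm (u + v))\<^sup>2 + (norm (u - v))\<^sup>2"
      by simp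
    also have "\<dots> = 2 * (norm u)\<^sup>2 + 2 * (norm v)\<^sup>2"
      by (simp add: power2_norm_eq_inner algebra_simps inner_commute)
    also have "\<dots> \<le> 2 * R\<^sup>2 + 2 * (norm v)\<^sup>2"
      using R[OF u] by (intro add_right_mono mult_left_mono power_mono) auto
    finally have "c / 2 * (norm (u + v))\<^sup>2 \<le> c / 2 * (2 * R\<^sup>2 + 2 * (norm v)\<^sup>2)"
      using assms by (intro mult_left_mono) auto
    then show ?thesis
      by (simp add: ennreal_mult[symmetric] exp_add[symmetric] algebra_simps)
  qed
  have "ennreal (exp (- c * R\<^sup>2)) * S = (\<integral>\<^sup>+u\<in>\<Omega>. ennreal (exp (- c * R\<^sup>2)) * S \<partial>lborel)"
    by (simp add: nn_integral_cmult_indicator emeasure_fund_domain)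
  also have "\<dots> \<le> (\<integral>\<^sup>+u\<in>\<Omega>. (\<integral>\<^sup>+v. ?g (u + v) \<partial>count_space L) \<partial>lborel)"
  proof (intro nn_integral_mono)
    fix u
    have "ennreal (exp (- c * R\<^sup>2)) * S \<le> (\<integral>\<^sup>+v. ?g (u + v) \<partial>count_space L)" if "u \<in> \<Omega>"
      unfolding S_def using le[OF that]
      by (subst nn_integral_cmult[symmetric]) (auto intro!: nn_integral_mono)
    then show "ennreal (exp (- c * R\<^sup>2)) * S * indicator \<Omega> u
        \<le> (\<integral>\<^sup>+v. ?g (u + v) \<partial>count_space L) * indicator \<Omega> u"
      by (cases "u \<in> \<Omega>") simp_all
  qed
  also have "\<dots> = (\<integral>\<^sup>+x. ?g x \<partial>lborel)"
    by (rule nn_integral_periodization[of ?g]) measurable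
  also have "\<dots> < \<infinity>"
    using nn_integral_gaussian[where ?'d='d, of "c / 2"] assms by simp
  finally show ?thesis
    unfolding S_def[symmetric] by (auto simp: ennreal_mult_less_top less_top[symmetric])
qed

text \<open>Pairing \<open>w\<close> with the basis vectors \<open>V *v axis i 1\<close> gives its
  coordinates in the dual basis. This makes the dual lattice an instance of the same locale.\<close>

lemma dual_lattice_eq: "dual_lattice V = lattice_of (transpose (matrix_inv V))"
proof (intro subset_antisym subsetI)
  fix w assume w: "w \<in> dual_lattice V"
  define k where "k = transpose V *v w"
  have "k $ i \<in> \<int>" for i
  proof -
    have "V *v axis i 1 \<in> L"
      unfolding lattice_of_def by (auto simp: axis_def)
    then have "w \<bullet> (V *v axis i 1) \<in> \<int>"
      using w by (simp add: dual_lattice_def)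
    also have "w \<bullet> (V *v axis i 1) = k $ i"
      by (simp add: k_def dot_lmul_matrix[symmetric] transpose_matrix_vector inner_axis)
    finally show ?thesis .
  qed
  moreover have "transpose (matrix_inv V) *v k = w"
  proof (rule vector_eq_rdot[THEN iffD1], rule allI)
    fix z
    show "(transpose (matrix_inv V) *v k) \<bullet> z = w \<bullet> z"
      by (simp add: k_def dot_lmul_matrix transpose_matrix_vector inv_V)
  qed
  ultimately show "w \<in> lattice_of (transpose (matrix_inv V))"
    unfolding lattice_of_def by blast
next
  fix w assume "w \<in> lattice_of (transpose (matrix_inv V))"
  then obtain k where k: "\<forall>i. k $ i \<in> \<int>" "w = transpose (matrix_inv V) *v k"
    by (auto simp: lattice_of_def)
  show "w \<in> dual_lattice V"
    unfolding dual_lattice_def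
  proof (intro CollectI ballI)
    fix v assume "v \<in> L"
    then obtain l where l: "\<forall>i. l $ i \<in> \<int>" "v = V *v l"
      by (auto simp: lattice_of_def)
    have "w \<bullet> v = k \<bullet> l"
      by (simp add: k l dot_lmul_matrix transpose_matrix_vector inv_V)
    also have "\<dots> \<in> \<int>"
      unfolding inner_vec_def using k l by (intro Ints_sum) auto
    finally show "w \<bullet> v \<in> \<int>" .
  qed
qed

lemma unimodular_dual: "unimodular_basis (transpose (matrix_inv V))"
proof
  have "matrix_inv V ** V = mat 1"
    by (simp add: matrix_eq matrix_vector_mul_assoc[symmetric] inv_V)
  then have "det (matrix_inv V) * det V = 1"
    by (metis det_mul det_I)
  then show "det (transpose (matrix_inv V)) = 1"
    by (simp add: det_V)
qed

lemma countable_dual: "countable (dual_lattice V - {0})"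
  using unimodular_basis.countable_lattice[OF unimodular_dual] by (simp add: dual_lattice_eq)

text \<open>For a nonzero dual vector, \<open>transpose V *v w\<close> is a nonzero integer vector,
  so one of its entries has absolute value at least 1; \<open>1 / K\<close> comes from the operator
  bound of \<open>transpose V\<close>.\<close>

lemma dual_lattice_norm_ge:
  obtains m where "0 < m" "\<And>w. w \<in> dual_lattice V - {0} \<Longrightarrow> m \<le> norm w"
proof -
  interpret bounded_linear "(*v) (transpose V)"
    by (rule matrix_vector_mul_bounded_linear)
  obtain K where K: "0 < K" "\<And>w. norm (transpose V *v w) \<le> norm w * K"
    using pos_bounded by blast
  show thesis
  proof (rule that[of "1 / K"])
    show "0 < 1 / K"
      using K by simp
    fix w assume w: "w \<in> dual_lattice V - {0}"
    then obtain k where k: "\<forall>i. k $ i \<in> \<int>" "w = transpose (matrix_inv V) *v k"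
      by (auto simp: dual_lattice_eq lattice_of_def)
    have Vw: "transpose V *v w = k"
    proof (rule vector_eq_rdot[THEN iffD1], rule allI)
      fix z
      show "(transpose V *v w) \<bullet> z = k \<bullet> z"
        by (simp add: k dot_lmul_matrix transpose_matrix_vector inv_V)
    qed
    have "k \<noteq> 0"
      using w k by auto
    then obtain i where "k $ i \<noteq> 0"
      by (auto simp: vec_eq_iff)
    then have "1 \<le> \<bar>k $ i\<bar>"
      using k by (intro Ints_nonzero_abs_ge1) auto
    also have "\<dots> \<le> norm w * K"
      using component_le_norm_cart[of k i] K(2)[of w] Vw by simp
    finally show "1 / K \<le> norm w"
      using K by (simp add: field_simps)
  qed
qed

text \<open>Comparison with a Gaussian sum over the dual lattice; the gap around 0 makes the
  coefficient bound uniform.\<close>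

lemma riesz_coeff_summable:
  assumes "0 < s"
  shows "riesz_coeff s summable_on (dual_lattice V - {0})"
proof -
  let ?D = "dual_lattice V"
  obtain m where m: "0 < m" "\<And>w. w \<in> ?D - {0} \<Longrightarrow> m \<le> norm w"
    using dual_lattice_norm_ge by blast
  obtain M where M: "0 \<le> M"
    "\<And>w :: real^'d. m \<le> norm w \<Longrightarrow> riesz_coeff s w \<le> M * exp (- (pi\<^sup>2 / 2) * (norm w)\<^sup>2)"
    using riesz_coeff_le[OF assms m(1)] by blast
  let ?e = "\<lambda>w::real^'d. ennreal (exp (- (pi\<^sup>2 / 2) * (norm w)\<^sup>2))"
  have "(\<integral>\<^sup>+w. ennreal (riesz_coeff s w) \<partial>count_space (?D - {0}))
      \<le> (\<integral>\<^sup>+w. ennreal M * ?e w \<partial>count_space (?D - {0}))"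
    using M m by (intro nn_integral_mono) (simp add: ennreal_mult[symmetric] ennreal_leI)
  also have "\<dots> \<le> (\<integral>\<^sup>+w. ennreal M * ?e w \<partial>count_space ?D)"
    by (simp add: nn_integral_count_space_indicator[of "?D - {0}"] nn_integral_count_space_indicator[of "?D"])
       (intro nn_integral_mono, auto simp: indicator_def)
  also have "\<dots> = ennreal M * (\<integral>\<^sup>+w. ?e w \<partial>count_space ?D)"
    by (rule nn_integral_cmult) simp
  also have "\<dots> < \<infinity>"
    using unimodular_basis.nn_integral_gaussian_lattice_finite[OF unimodular_dual, of "pi\<^sup>2 / 2"]
    by (simp add: dual_lattice_eq ennreal_mult_less_top)
  finally show ?thesis
    by (intro summable_on_nn_integral riesz_coeff_nonneg)
qed

definition dual_part :: "real \<Rightarrow> real^'d \<Rightarrow> real" where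
  "dual_part s u = (\<Sum>\<^sub>\<infinity>w\<in>dual_lattice V - {0}. riesz_coeff s w * cos (2 * pi * (w \<bullet> u)))"

lemma dual_part_summable:
  assumes "0 < s"
  shows "(\<lambda>w. riesz_coeff s w * cos (2 * pi * (w \<bullet> u))) summable_on (dual_lattice V - {0})"
proof -
  have "(\<lambda>w. norm (riesz_coeff s w * cos (2 * pi * (w \<bullet> u)))) summable_on (dual_lattice V - {0})"
    by (rule summable_on_comparison_test[OF riesz_coeff_summable[OF assms]])
      (auto simp: abs_mult riesz_coeff_nonneg mult_left_le)
  then show ?thesis
    by (rule abs_summable_summable)
qed

text \<open>The coefficients are real and absolutely summable, so the real part can be taken
  termwise and turns each exponential into a cosine.\<close>

lemma Re_dual_sum:
  assumes "0 < s"
  shows "Re (\<Sum>\<^sub>\<infinity>w\<in>dual_lattice V - {0}.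
     exp (2 * of_real pi * \<i> * of_real (w \<bullet> u)) * of_real (riesz_coeff s w)) = dual_part s u"
proof -
  have *: "exp (2 * of_real pi * \<i> * of_real r) = cis (2 * pi * r)" for r
    by (simp add: cis_conv_exp algebra_simps)
  have "(\<lambda>w. norm (cis (2 * pi * (w \<bullet> u)) * of_real (riesz_coeff s w))) summable_on (dual_lattice V - {0})"
    using riesz_coeff_summable[OF assms] by (simp add: norm_mult riesz_coeff_nonneg)
  then have "(\<lambda>w. cis (2 * pi * (w \<bullet> u)) * of_real (riesz_coeff s w)) summable_on (dual_lattice V - {0})"
    by (rule abs_summable_summable)
  from infsum_Re[OF this] show ?thesis
    unfolding dual_part_def * by (simp add: mult.commute)
qed

lemma dual_part_0: "dual_part s 0 = (\<Sum>\<^sub>\<infinity>w\<in>dual_lattice V - {0}. riesz_coeff s w)"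
  by (simp add: dual_part_def)

lemma dual_part_uminus: "dual_part s (- u) = dual_part s u"
  by (simp add: dual_part_def)

lemma dual_part_periodic:
  assumes "v \<in> L"
  shows "dual_part s (u + v) = dual_part s u"
proof -
  have "cos (2 * pi * (w \<bullet> (u + v))) = cos (2 * pi * (w \<bullet> u))" if w: "w \<in> dual_lattice V - {0}" for w
  proof -
    obtain n where "w \<bullet> v = of_int n"
      using w assms by (auto simp: dual_lattice_def elim!: Ints_cases)
    then show ?thesis
      by (simp add: inner_add_right distrib_left cos_add)
  qed
  then show ?thesis
    unfolding dual_part_def by (intro infsum_cong) simp
qed

text \<open>Adding the value at 0 replaces \<open>cos\<close> by \<open>1 + cos\<close>, so the
  series has nonnegative terms and is open to Tonelli and to measurability arguments in
  \<open>ennreal\<close>.\<close>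

lemma ennreal_dual_part:
  assumes "0 < s"
  shows "ennreal (dual_part s u + dual_part s 0)
    = (\<integral>\<^sup>+w. ennreal (riesz_coeff s w * (1 + cos (2 * pi * (w \<bullet> u)))) \<partial>count_space (dual_lattice V - {0}))"
    and "0 \<le> dual_part s u + dual_part s 0"
proof -
  have nn: "0 \<le> riesz_coeff s w * (1 + cos (2 * pi * (w \<bullet> u)))" for w
    using cos_ge_minus_one[of "2 * pi * (w \<bullet> u)"]
    by (intro mult_nonneg_nonneg riesz_coeff_nonneg) linarith
  have sm: "(\<lambda>w. riesz_coeff s w * (1 + cos (2 * pi * (w \<bullet> u)))) summable_on (dual_lattice V - {0})"
    unfolding distrib_left
    by (intro summable_on_add dual_part_summable) (simp_all add: assms riesz_coeff_summable)
  have eq: "dual_part s u + dual_part s 0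
      = (\<Sum>\<^sub>\<infinity>w\<in>dual_lattice V - {0}. riesz_coeff s w * (1 + cos (2 * pi * (w \<bullet> u))))"
    unfolding dual_part_def distrib_left
    by (subst infsum_add) (use assms in \<open>simp_all add: riesz_coeff_summable dual_part_summable add.commute\<close>)
  show "ennreal (dual_part s u + dual_part s 0)
    = (\<integral>\<^sup>+w. ennreal (riesz_coeff s w * (1 + cos (2 * pi * (w \<bullet> u)))) \<partial>count_space (dual_lattice V - {0}))"
    unfolding eq by (intro ennreal_infsum_eq_nn_integral sm nn)
  show "0 \<le> dual_part s u + dual_part s 0"
    unfolding eq by (intro infsum_nonneg nn)
qed

lemma dual_part_0_nonneg: "0 \<le> dual_part s 0"
  unfolding dual_part_0 by (intro infsum_nonneg riesz_coeff_nonneg)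

text \<open>Translation by a half period exchanges \<open>1 + cos\<close> and
  \<open>1 - cos\<close>; their integrals are thus equal, and they add up to 2 because
  \<open>\<Omega>\<close> has volume 1.\<close>

lemma nn_integral_one_plus_cos:
  assumes w: "w \<in> dual_lattice V - {0}"
  shows "(\<integral>\<^sup>+u\<in>\<Omega>. ennreal (1 + cos (2 * pi * (w \<bullet> u))) \<partial>lborel) = 1"
proof -
  let ?f = "\<lambda>u. ennreal (1 + cos (2 * pi * (w \<bullet> u)))" and ?g = "\<lambda>u. ennreal (1 - cos (2 * pi * (w \<bullet> u)))"
  \<comment> \<open>The multiple of \<open>w\<close> with \<open>w \<bullet> a = 1 / 2\<close>,
    which shifts the phase by \<open>pi\<close>.\<close>
  define a where "a = (1 / (2 * (w \<bullet> w))) *\<^sub>R w"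
  have wa: "w \<bullet> a = 1 / 2"
    using w by (simp add: a_def)
  have "cos (2 * pi * (w \<bullet> (u + a))) = - cos (2 * pi * (w \<bullet> u))" for u
    by (simp add: inner_add_right wa distrib_left)
  then have "(\<integral>\<^sup>+u\<in>\<Omega>. ?g u \<partial>lborel) = (\<integral>\<^sup>+u\<in>\<Omega>. ?f (u + a) \<partial>lborel)"
    by simp
  also have "\<dots> = (\<integral>\<^sup>+u\<in>\<Omega>. ?f u \<partial>lborel)"
  proof (rule nn_integral_fund_domain_shift)
    show "?f \<in> borel_measurable borel"
      by measurable
    fix x v assume "v \<in> L"
    then obtain n where "w \<bullet> v = of_int n"
      using w by (auto simp: dual_lattice_def elim!: Ints_cases)
    then show "?f (x + v) = ?f x"
      by (simp add: inner_add_right distrib_left cos_add)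
  qed
  finally have eq: "(\<integral>\<^sup>+u\<in>\<Omega>. ?g u \<partial>lborel) = (\<integral>\<^sup>+u\<in>\<Omega>. ?f u \<partial>lborel)" .
  have "(\<integral>\<^sup>+u\<in>\<Omega>. ?f u \<partial>lborel) + (\<integral>\<^sup>+u\<in>\<Omega>. ?g u \<partial>lborel) = (\<integral>\<^sup>+u\<in>\<Omega>. (?f u + ?g u) \<partial>lborel)"
    by (subst nn_integral_add[symmetric]) (auto simp: distrib_right)
  also have "\<dots> = (\<integral>\<^sup>+u\<in>\<Omega>. 2 \<partial>lborel)"
  proof (intro nn_integral_cong arg_cong2[of _ _ _ _ "(*)"] refl)
    fix u
    have "0 \<le> 1 + cos (2 * pi * (w \<bullet> u))" "0 \<le> 1 - cos (2 * pi * (w \<bullet> u))"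
      using cos_ge_minus_one[of "2 * pi * (w \<bullet> u)"] cos_le_one[of "2 * pi * (w \<bullet> u)"] by linarith+
    then show "?f u + ?g u = 2"
      by (subst ennreal_plus[symmetric]) simp_all
  qed
  also have "\<dots> = 2"
    by (simp add: nn_integral_cmult_indicator emeasure_fund_domain)
  finally have "(\<integral>\<^sup>+u\<in>\<Omega>. ?f u \<partial>lborel) + (\<integral>\<^sup>+u\<in>\<Omega>. ?f u \<partial>lborel) = 2"
    by (simp only: eq)
  moreover have "I = 1" if "I + I = 2" for I :: ennreal
    using that by (cases I) (simp_all flip: ennreal_plus ennreal_1 ennreal_numeral)
  ultimately show ?thesis
    by blast
qed

text \<open>The shifted form of the fact that the dual part has mean zero: only the added constant
  survives.\<close>

lemma nn_integral_dual_part: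
  assumes "0 < s"
  shows "(\<integral>\<^sup>+u\<in>\<Omega>. ennreal (dual_part s u + dual_part s 0) \<partial>lborel) = ennreal (dual_part s 0)"
proof -
  let ?D = "dual_lattice V - {0}"
  have "(\<integral>\<^sup>+u\<in>\<Omega>. ennreal (dual_part s u + dual_part s 0) \<partial>lborel)
      = (\<integral>\<^sup>+u. (\<integral>\<^sup>+w. ennreal (riesz_coeff s w) * ennreal (1 + cos (2 * pi * (w \<bullet> u))) * indicator \<Omega> u \<partial>count_space ?D) \<partial>lborel)"
    unfolding ennreal_dual_part(1)[OF assms]
    by (subst nn_integral_multc) (simp_all add: ennreal_mult' riesz_coeff_nonneg)
  also have "\<dots> = (\<integral>\<^sup>+w. (\<integral>\<^sup>+u. ennreal (riesz_coeff s w) * (ennreal (1 + cos (2 * pi * (w \<bullet> u))) * indicator \<Omega> u) \<partial>lborel) \<partial>count_space ?D)"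
    unfolding mult.assoc by (rule nn_integral_count_space_nn_integral[OF countable_dual]) measurable
  also have "\<dots> = (\<integral>\<^sup>+w. ennreal (riesz_coeff s w) \<partial>count_space ?D)"
    by (intro nn_integral_cong) (simp add: nn_integral_cmult nn_integral_one_plus_cos)
  also have "\<dots> = ennreal (dual_part s 0)"
    unfolding dual_part_0
    by (intro ennreal_infsum_eq_nn_integral[symmetric] riesz_coeff_summable riesz_coeff_nonneg assms)
  finally show ?thesis .
qed

text \<open>For each frequency, the addition theorem turns the double sum of cosines into the square
  of a cosine sum plus the square of a sine sum, weighted by a nonnegative coefficient.\<close>

lemma dual_part_positive_definite:
  assumes "0 < s" "finite J"
  shows "0 \<le> (\<Sum>j\<in>J. \<Sum>k\<in>J. dual_part s (x j - x k))"
proof -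
  have "((\<lambda>w. \<Sum>j\<in>J. \<Sum>k\<in>J. riesz_coeff s w * cos (2 * pi * (w \<bullet> (x j - x k))))
      has_sum (\<Sum>j\<in>J. \<Sum>k\<in>J. dual_part s (x j - x k))) (dual_lattice V - {0})"
    unfolding dual_part_def by (intro has_sum_sum has_sum_infsum dual_part_summable assms)
  moreover have "0 \<le> (\<Sum>j\<in>J. \<Sum>k\<in>J. riesz_coeff s w * cos (2 * pi * (w \<bullet> (x j - x k))))" for w
  proof -
    have "(\<Sum>j\<in>J. cos (2 * pi * (w \<bullet> x j)))\<^sup>2
          = (\<Sum>j\<in>J. \<Sum>k\<in>J. cos (2 * pi * (w \<bullet> x j)) * cos (2 * pi * (w \<bullet> x k)))"
        "(\<Sum>j\<in>J. sin (2 * pi * (w \<bullet> x j)))\<^sup>2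
          = (\<Sum>j\<in>J. \<Sum>k\<in>J. sin (2 * pi * (w \<bullet> x j)) * sin (2 * pi * (w \<bullet> x k)))"
      by (simp_all only: power2_eq_square sum_product)
    then have "(\<Sum>j\<in>J. \<Sum>k\<in>J. riesz_coeff s w * cos (2 * pi * (w \<bullet> (x j - x k))))
        = riesz_coeff s w * ((\<Sum>j\<in>J. cos (2 * pi * (w \<bullet> x j)))\<^sup>2 + (\<Sum>j\<in>J. sin (2 * pi * (w \<bullet> x j)))\<^sup>2)"
      by (simp add: inner_diff_right right_diff_distrib cos_diff sum.distrib
          sum_distrib_left distrib_left)
    then show ?thesis
      by (simp add: riesz_coeff_nonneg)
  qed
  ultimately show ?thesis
    by (rule has_sum_nonneg)
qed

end

subsection \<open>The lattice sum\<close>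

lemma sets_riesz_measure [measurable_cong, simp]: "sets (riesz_measure s) = sets borel"
  by (simp add: riesz_measure_def)

lemma nn_integral_riesz_measure:
  assumes [measurable]: "f \<in> borel_measurable borel"
  shows "(\<integral>\<^sup>+t. f t \<partial>riesz_measure s)
    = (\<integral>\<^sup>+t. ennreal (indicator {0<..} t * (t powr (s/2 - 1) / Gamma (s/2))) * f t \<partial>lborel)"
  unfolding riesz_measure_def by (rule nn_integral_density) measurable

text \<open>The value \<open>C\<close> of the overview; the type argument only carries the
  dimension.\<close>

definition riesz_constant :: "'d::finite itself \<Rightarrow> real \<Rightarrow> real" where
  "riesz_constant d s = 2 * pi powr (CARD('d) / 2) / (Gamma (s/2) * (real CARD('d) - s))"

lemma riesz_constant_pos:
  assumes "0 < s" "s < real CARD('d)"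
  shows "0 < riesz_constant TYPE('d::finite) s"
proof -
  have "0 < Gamma (s / 2)"
    using assms by (intro Gamma_real_pos) simp
  then show ?thesis
    using assms by (simp add: riesz_constant_def)
qed

text \<open>With \<open>e = (s - d) / 2 < 0\<close> and the constant \<open>C\<close>, the integrand
  is the derivative of \<open>- C * t powr e\<close>, which tends to 0 at infinity. The case
  \<open>a = 1\<close> is the mean of the lattice sum, the case \<open>a = T\<close> the loss by
  truncation.\<close>

lemma nn_integral_riesz_tail:
  assumes s: "0 < s" "s < real CARD('d::finite)" and a: "1 \<le> a"
  shows "(\<integral>\<^sup>+t\<in>{a<..}. ennreal ((pi / t) powr (CARD('d) / 2)) \<partial>riesz_measure s)
    = ennreal (riesz_constant TYPE('d) s * a powr ((s - real CARD('d)) / 2))"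
proof -
  define C where "C = riesz_constant TYPE('d) s"
  define e where "e = (s - real CARD('d)) / 2"
  have e: "e < 0"
    using s by (simp add: e_def)
  have G: "0 < Gamma (s / 2)"
    using s by (intro Gamma_real_pos) simp
  have C: "0 < C"
    unfolding C_def using s by (rule riesz_constant_pos)
  have eq: "t powr (s / 2 - 1) / Gamma (s / 2) * (pi / t) powr (CARD('d) / 2) = - C * (e * t powr (e - 1))"
    if t: "0 < t" for t
  proof -
    have "t powr (s / 2 - 1) / t powr (CARD('d) / 2) = t powr (e - 1)"
      unfolding powr_diff[symmetric] by (simp add: e_def diff_divide_distrib algebra_simps)
    moreover have "- C * e = pi powr (CARD('d) / 2) / Gamma (s / 2)"
    proof -
      define \<delta> where "\<delta> = real CARD('d) - s"
      have \<delta>: "\<delta> = - 2 * e"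
        using s by (simp add: e_def \<delta>_def)
      have "C = 2 * pi powr (CARD('d) / 2) / (Gamma (s / 2) * \<delta>)"
        by (simp add: C_def riesz_constant_def \<delta>_def)
      then show ?thesis
        using G e unfolding \<delta> by (simp add: field_simps)
    qed
    moreover have "t powr (s / 2 - 1) / Gamma (s / 2) * (pi / t) powr (CARD('d) / 2)
        = pi powr (CARD('d) / 2) / Gamma (s / 2) * (t powr (s / 2 - 1) / t powr (CARD('d) / 2))"
      by (simp add: powr_divide)
    ultimately show ?thesis
      by (simp only: mult.assoc[symmetric])
  qed
  have "(\<integral>\<^sup>+t\<in>{a<..}. ennreal ((pi / t) powr (CARD('d) / 2)) \<partial>riesz_measure s)
      = (\<integral>\<^sup>+t. ennreal (indicator {0<..} t * (t powr (s/2 - 1) / Gamma (s/2)))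
          * (ennreal ((pi / t) powr (CARD('d) / 2)) * indicator {a<..} t) \<partial>lborel)"
    by (rule nn_integral_riesz_measure) measurable
  \<comment> \<open>\<open>nn_integral_FTC_atLeast\<close> integrates over a closed half-line; the
    endpoint is a null set.\<close>
  also have "\<dots> = (\<integral>\<^sup>+t. ennreal (- C * (e * t powr (e - 1))) * indicator {a ..} t \<partial>lborel)"
  proof (rule nn_integral_cong_AE)
    show "AE t in lborel. ennreal (indicator {0<..} t * (t powr (s/2 - 1) / Gamma (s/2)))
          * (ennreal ((pi / t) powr (CARD('d) / 2)) * indicator {a<..} t)
        = ennreal (- C * (e * t powr (e - 1))) * indicator {a ..} t"
      using AE_lborel_singleton[of a]
    proof eventually_elim
      case (elim t)
      show ?case
      proof (cases "a < t")
        case True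
        then have "0 < t"
          using a by simp
        then show ?thesis
          using True G eq[of t] by (simp add: ennreal_mult[symmetric])
      qed (use elim in simp)
    qed
  qed
  also have "\<dots> = ennreal (0 - (- C * a powr e))"
  proof (rule nn_integral_FTC_atLeast)
    show "((\<lambda>t. - C * t powr e) \<longlongrightarrow> 0) at_top"
      using tendsto_mult_right_zero[OF tendsto_neg_powr[OF e filterlim_ident], of "- C"] by simp
    fix t assume t: "a \<le> t"
    then show "((\<lambda>t. - C * t powr e) has_real_derivative - C * (e * t powr (e - 1))) (at t)"
      using a by (auto intro!: derivative_eq_intros)
    show "0 \<le> - C * (e * t powr (e - 1))"
      using C e by (simp add: mult_nonneg_nonpos mult_nonpos_nonneg zero_le_mult_iff mult_le_0_iff)
  qed measurable
  finally show ?thesis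
    by (simp add: C_def e_def)
qed

lemma nn_integral_riesz_truncated:
  assumes s: "0 < s" "s < real CARD('d::finite)" and T: "1 \<le> T"
  shows "(\<integral>\<^sup>+t\<in>{1<..T}. ennreal ((pi / t) powr (CARD('d) / 2)) \<partial>riesz_measure s)
    = ennreal (riesz_constant TYPE('d) s * (1 - T powr ((s - real CARD('d)) / 2)))"
proof -
  let ?f = "\<lambda>t. ennreal ((pi / t) powr (CARD('d) / 2))"
  define C where "C = riesz_constant TYPE('d) s"
  have C: "0 < C"
    unfolding C_def using s by (rule riesz_constant_pos)
  define X where "X = (\<integral>\<^sup>+t\<in>{1<..T}. ?f t \<partial>riesz_measure s)"
  have "ennreal (C * 1 powr ((s - real CARD('d)) / 2)) = (\<integral>\<^sup>+t\<in>{1<..}. ?f t \<partial>riesz_measure s)"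
    unfolding C_def by (rule nn_integral_riesz_tail[symmetric]) (use s in auto)
  also have "\<dots> = (\<integral>\<^sup>+t. ?f t * indicator {1<..T} t + ?f t * indicator {T<..} t \<partial>riesz_measure s)"
    using T by (intro nn_integral_cong) (auto simp: indicator_def)
  also have "\<dots> = X + (\<integral>\<^sup>+t\<in>{T<..}. ?f t \<partial>riesz_measure s)"
    unfolding X_def by (rule nn_integral_add) measurable
  also have "(\<integral>\<^sup>+t\<in>{T<..}. ?f t \<partial>riesz_measure s) = ennreal (C * T powr ((s - real CARD('d)) / 2))"
    unfolding C_def by (rule nn_integral_riesz_tail) (use s T in auto)
  finally have "X + ennreal (C * T powr ((s - real CARD('d)) / 2)) = ennreal C"
    by simp
  then have "X = ennreal C - ennreal (C * T powr ((s - real CARD('d)) / 2))"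
    by (metis ennreal_add_diff_cancel_right ennreal_neq_top)
  also have "\<dots> = ennreal (C - C * T powr ((s - real CARD('d)) / 2))"
    using C by (intro ennreal_minus) simp
  finally show ?thesis
    by (simp add: X_def C_def right_diff_distrib)
qed

text \<open>Completing the square around the midpoint of \<open>x\<close> and \<open>y\<close>: two
  Gaussians of rate \<open>2 * t\<close> convolve to one of rate \<open>t\<close>.\<close>

lemma nn_integral_gaussian_product:
  fixes x y :: "real^'d"
  assumes t: "0 < t"
  shows "(\<integral>\<^sup>+z. ennreal (exp (- (2 * t) * (norm (z - x))\<^sup>2)) * ennreal (exp (- (2 * t) * (norm (z - y))\<^sup>2)) \<partial>lborel)
    = ennreal ((pi / (4 * t)) powr (CARD('d) / 2)) * ennreal (exp (- (norm (x - y))\<^sup>2 * t))"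
proof -
  let ?g = "\<lambda>z::real^'d. ennreal (exp (- (4 * t) * (norm z)\<^sup>2))"
  define c where "c = (1/2) *\<^sub>R (x + y)"
  have "(norm (z - x))\<^sup>2 + (norm (z - y))\<^sup>2 = 2 * (norm (z + - c))\<^sup>2 + (norm (x - y))\<^sup>2 / 2" for z
    by (simp add: c_def power2_norm_eq_inner algebra_simps inner_commute) (simp add: field_simps)
  from arg_cong[OF this, of "\<lambda>a. - (2 * t) * a"]
  have "- (2 * t) * (norm (z - x))\<^sup>2 + - (2 * t) * (norm (z - y))\<^sup>2
      = - (norm (x - y))\<^sup>2 * t + - (4 * t) * (norm (z + - c))\<^sup>2" for z
    by (simp add: algebra_simps)
  then have "ennreal (exp (- (2 * t) * (norm (z - x))\<^sup>2)) * ennreal (exp (- (2 * t) * (norm (z - y))\<^sup>2))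
      = ennreal (exp (- (norm (x - y))\<^sup>2 * t)) * ?g (z + - c)" for z
    by (simp only: ennreal_mult[symmetric] exp_ge_zero exp_add[symmetric])
  then have "(\<integral>\<^sup>+z. ennreal (exp (- (2 * t) * (norm (z - x))\<^sup>2)) * ennreal (exp (- (2 * t) * (norm (z - y))\<^sup>2)) \<partial>lborel)
      = ennreal (exp (- (norm (x - y))\<^sup>2 * t)) * (\<integral>\<^sup>+z. ?g (z + - c) \<partial>lborel)"
    by (simp only:) (rule nn_integral_cmult, measurable)
  also have "(\<integral>\<^sup>+z. ?g (z + - c) \<partial>lborel) = (\<integral>\<^sup>+z. ?g z \<partial>lborel)"
    by (rule nn_integral_lborel_shift) measurable
  also have "\<dots> = ennreal ((pi / (4 * t)) powr (CARD('d) / 2))"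
    using t by (intro nn_integral_gaussian) simp
  finally show ?thesis
    by (simp only: mult.commute)
qed

section \<open>The periodized Gaussian and the mean of the lattice sum\<close>

context unimodular_basis
begin

definition theta :: "real \<Rightarrow> real^'d \<Rightarrow> ennreal" where
  "theta t u = (\<integral>\<^sup>+v. ennreal (exp (- (norm (u + v))\<^sup>2 * t)) \<partial>count_space L)"

text \<open>The \<open>A\<close> of the overview. The name refers to real space, as opposed to the
  dual lattice, in the manner of Ewald summation.\<close>

definition real_part :: "real \<Rightarrow> real^'d \<Rightarrow> ennreal" where
  "real_part s u = (\<integral>\<^sup>+v. (\<integral>\<^sup>+t\<in>{1<..}. ennreal (exp (- (norm (u + v))\<^sup>2 * t)) \<partial>riesz_measure s) \<partial>count_space L)"

lemma theta_eq: "theta t u = (\<integral>\<^sup>+v. ennreal (exp (- t * (norm (u + v))\<^sup>2)) \<partial>count_space L)"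
  by (simp add: theta_def mult.commute)

lemma measurable_theta [measurable]: "(\<lambda>t. theta t u) \<in> borel_measurable borel"
    "theta t \<in> borel_measurable borel"
  unfolding theta_def
  by (rule borel_measurable_nn_integral_count_space[OF countable_lattice], measurable)+

lemma lattice_sum_shift:
  assumes "w \<in> L"
  shows "(\<integral>\<^sup>+v. f (u + w + v) \<partial>count_space L) = (\<integral>\<^sup>+v. f (u + v) \<partial>count_space L)"
  using nn_integral_bij_count_space[OF bij_lattice_shift[OF assms], of "\<lambda>v. f (u + v)"]
  by (simp add: ac_simps)

lemma lattice_sum_uminus:
  fixes f :: "real^'d \<Rightarrow> ennreal"
  assumes "\<And>x. f (- x) = f x"
  shows "(\<integral>\<^sup>+v. f (- u + v) \<partial>count_space L) = (\<integral>\<^sup>+v. f (u + v) \<partial>count_space L)"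
proof -
  have "f (- u + - v) = f (u + v)" for v
    using assms[of "u + v"] by simp
  then show ?thesis
    using nn_integral_bij_count_space[OF bij_lattice_uminus, of "\<lambda>v. f (- u + v)"] by simp
qed

lemma theta_periodic: "v \<in> L \<Longrightarrow> theta t (u + v) = theta t u"
  unfolding theta_def by (rule lattice_sum_shift)

lemma real_part_periodic: "v \<in> L \<Longrightarrow> real_part s (u + v) = real_part s u"
  unfolding real_part_def by (rule lattice_sum_shift)

lemma real_part_uminus: "real_part s (- u) = real_part s u"
  unfolding real_part_def by (rule lattice_sum_uminus) simp

lemma real_part_eq: "real_part s u = (\<integral>\<^sup>+t\<in>{1<..}. theta t u \<partial>riesz_measure s)"
proof -
  have "real_part s u = (\<integral>\<^sup>+t. (\<integral>\<^sup>+v. ennreal (exp (- (norm (u + v))\<^sup>2 * t)) * indicator {1<..} t \<partial>count_space L) \<partial>riesz_measure s)"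
    unfolding real_part_def
    by (rule nn_integral_count_space_nn_integral[OF countable_lattice, symmetric]) measurable
  then show ?thesis
    by (simp add: theta_def nn_integral_multc)
qed

lemma measurable_lattice_summand [measurable]:
  "(\<lambda>x::real^'d. \<integral>\<^sup>+t\<in>{1<..}. ennreal (exp (- (norm x)\<^sup>2 * t)) \<partial>riesz_measure s) \<in> borel_measurable borel"
  by (subst nn_integral_riesz_measure) measurable

lemma measurable_real_part [measurable]: "real_part s \<in> borel_measurable borel"
  unfolding real_part_def
  by (rule borel_measurable_nn_integral_count_space[OF countable_lattice]) measurable

lemma nn_integral_real_part:
  assumes s: "0 < s" "s < real CARD('d)"
  shows "(\<integral>\<^sup>+u\<in>\<Omega>. real_part s u \<partial>lborel) = ennreal (riesz_constant TYPE('d) s)"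
proof -
  let ?\<rho> = "\<lambda>t. ennreal (indicator {0<..} t * (t powr (s/2 - 1) / Gamma (s/2)))"
  have "(\<integral>\<^sup>+u\<in>\<Omega>. real_part s u \<partial>lborel)
      = (\<integral>\<^sup>+x. (\<integral>\<^sup>+t\<in>{1<..}. ennreal (exp (- (norm x)\<^sup>2 * t)) \<partial>riesz_measure s) \<partial>(lborel :: (real^'d) measure))"
    unfolding real_part_def by (rule nn_integral_periodization) measurable
  \<comment> \<open>Writing the Riesz measure through its density makes this a double integral over
    two Lebesgue measures, to which Tonelli applies.\<close>
  also have "\<dots> = (\<integral>\<^sup>+x. (\<integral>\<^sup>+t. ?\<rho> t * (ennreal (exp (- (norm x)\<^sup>2 * t)) * indicator {1<..} t) \<partial>lborel) \<partial>(lborel :: (real^'d) measure))"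
    by (subst nn_integral_riesz_measure) simp_all
  also have "\<dots> = (\<integral>\<^sup>+t. (\<integral>\<^sup>+x. ?\<rho> t * (ennreal (exp (- (norm x)\<^sup>2 * t)) * indicator {1<..} t) \<partial>(lborel :: (real^'d) measure)) \<partial>lborel)"
    by (rule lborel_pair.Fubini'[symmetric]) measurable
  also have "\<dots> = (\<integral>\<^sup>+t. ?\<rho> t * (ennreal ((pi / t) powr (CARD('d) / 2)) * indicator {1<..} t) \<partial>lborel)"
  proof (rule nn_integral_cong)
    fix t :: real
    have "(\<integral>\<^sup>+x. ennreal (exp (- (norm x)\<^sup>2 * t)) \<partial>(lborel :: (real^'d) measure)) = ennreal ((pi / t) powr (CARD('d) / 2))"
      if "1 < t"
      using nn_integral_gaussian[where ?'d='d, of t] that by (simp add: mult.commute)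
    then show "(\<integral>\<^sup>+x. ?\<rho> t * (ennreal (exp (- (norm x)\<^sup>2 * t)) * indicator {1<..} t) \<partial>(lborel :: (real^'d) measure))
        = ?\<rho> t * (ennreal ((pi / t) powr (CARD('d) / 2)) * indicator {1<..} t)"
      by (cases "1 < t") (simp_all add: nn_integral_cmult)
  qed
  also have "\<dots> = (\<integral>\<^sup>+t\<in>{1<..}. ennreal ((pi / t) powr (CARD('d) / 2)) \<partial>riesz_measure s)"
    by (rule nn_integral_riesz_measure[symmetric]) measurable
  also have "\<dots> = ennreal (riesz_constant TYPE('d) s)"
    using nn_integral_riesz_tail[OF s, of 1] by simp
  finally show ?thesis .
qed

text \<open>The theta function is a convolution square on the torus, hence positive definite.\<close>

lemma nn_integral_theta_product:
  assumes t: "0 < t"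
  shows "(\<integral>\<^sup>+z\<in>\<Omega>. theta (2 * t) (z - x) * theta (2 * t) (z - y) \<partial>lborel)
    = ennreal ((pi / (4 * t)) powr (CARD('d) / 2)) * theta t (x - y)"
proof -
  let ?h = "\<lambda>u::real^'d. ennreal (exp (- (2 * t) * (norm u)\<^sup>2))"
  have th: "theta (2 * t) u = (\<integral>\<^sup>+v. ?h (u + v) \<partial>count_space L)" for u
    by (simp only: theta_eq)
  \<comment> \<open>Only the first factor is expanded. The second one is periodic and is shifted
    along with \<open>v\<close>, so the whole product is a periodization and can be
    unfolded.\<close>
  have "(\<integral>\<^sup>+z\<in>\<Omega>. theta (2 * t) (z - x) * theta (2 * t) (z - y) \<partial>lborel)
      = (\<integral>\<^sup>+z\<in>\<Omega>. (\<integral>\<^sup>+v. ?h (z + v - x) * theta (2 * t) (z + v - y) \<partial>count_space L) \<partial>lborel)"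
  proof (intro nn_integral_cong arg_cong2[of _ _ _ _ "(*)"] refl)
    fix z
    have "(\<integral>\<^sup>+v. ?h (z + v - x) * theta (2 * t) (z + v - y) \<partial>count_space L)
        = (\<integral>\<^sup>+v. ?h (z - x + v) * theta (2 * t) (z - y) \<partial>count_space L)"
    proof (rule nn_integral_cong)
      fix v assume "v \<in> space (count_space L)"
      then have "theta (2 * t) (z - y + v) = theta (2 * t) (z - y)"
        by (intro theta_periodic) simp
      moreover have "z + v - x = z - x + v" "z + v - y = z - y + v"
        by simp_all
      ultimately show "?h (z + v - x) * theta (2 * t) (z + v - y) = ?h (z - x + v) * theta (2 * t) (z - y)"
        by (simp only:)
    qed
    then show "theta (2 * t) (z - x) * theta (2 * t) (z - y)
        = (\<integral>\<^sup>+v. ?h (z + v - x) * theta (2 * t) (z + v - y) \<partial>count_space L)"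
      by (simp only: th nn_integral_multc measurable_count_space_eq1)
        (subst nn_integral_multc, simp_all)
  qed
  also have "\<dots> = (\<integral>\<^sup>+z. ?h (z - x) * theta (2 * t) (z - y) \<partial>lborel)"
    by (rule nn_integral_periodization[of "\<lambda>z. ?h (z - x) * theta (2 * t) (z - y)"]) measurable
  \<comment> \<open>The remaining factor becomes a sum of Gaussians centred at \<open>y - v\<close>;
    pairing each with the one at \<open>x\<close> yields the summands of
    \<open>theta t (x - y)\<close>.\<close>
  also have "\<dots> = (\<integral>\<^sup>+z. (\<integral>\<^sup>+v. ?h (z - x) * ?h (z - (y - v)) \<partial>count_space L) \<partial>lborel)"
  proof (rule nn_integral_cong)
    fix z
    have "z - y + v = z - (y - v)" for v
      by simp
    then show "?h (z - x) * theta (2 * t) (z - y) = (\<integral>\<^sup>+v. ?h (z - x) * ?h (z - (y - v)) \<partial>count_space L)"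
      by (simp only: th nn_integral_cmult[OF borel_measurable_count_space])
  qed
  also have "\<dots> = (\<integral>\<^sup>+v. (\<integral>\<^sup>+z. ?h (z - x) * ?h (z - (y - v)) \<partial>lborel) \<partial>count_space L)"
    by (rule nn_integral_count_space_nn_integral[OF countable_lattice]) measurable
  also have "\<dots> = (\<integral>\<^sup>+v. ennreal ((pi / (4 * t)) powr (CARD('d) / 2)) * ennreal (exp (- (norm (x - (y - v)))\<^sup>2 * t)) \<partial>count_space L)"
    by (simp only: nn_integral_gaussian_product[OF t])
  also have "\<dots> = ennreal ((pi / (4 * t)) powr (CARD('d) / 2)) * theta t (x - y)"
    unfolding theta_def by (subst nn_integral_cmult) (simp_all add: algebra_simps)
  finally show ?thesis .
qed

text \<open>The sum \<open>S\<close> of the translates of \<open>theta (2 * t)\<close> has a known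
  mean, and the integral of its square is a constant times the pair sum of \<open>theta t\<close>.
  Comparing the two by Cauchy-Schwarz and cancelling the constant leaves the mean
  \<open>(pi / t) powr (d/2)\<close> of \<open>theta t\<close>.\<close>

lemma theta_positive_definite:
  assumes t: "0 < t" and J: "finite J"
  shows "ennreal ((real (card J))\<^sup>2 * (pi / t) powr (CARD('d) / 2)) \<le> (\<Sum>j\<in>J. \<Sum>k\<in>J. theta t (x j - x k))"
proof -
  define h where "h = real CARD('d) / 2"
  define S where "S = (\<lambda>z. \<Sum>j\<in>J. theta (2 * t) (z - x j))"
  have [measurable]: "S \<in> borel_measurable borel"
    unfolding S_def by measurable
  let ?K = "ennreal ((pi / (4 * t)) powr h)"
  have mean: "(\<integral>\<^sup>+z\<in>\<Omega>. theta (2 * t) (z - a) \<partial>lborel) = ennreal ((pi / (2 * t)) powr h)" for a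
  proof -
    have "(\<integral>\<^sup>+z\<in>\<Omega>. theta (2 * t) (z + - a) \<partial>lborel) = (\<integral>\<^sup>+z\<in>\<Omega>. theta (2 * t) z \<partial>lborel)"
      by (rule nn_integral_fund_domain_shift, measurable) (rule theta_periodic)
    also have "\<dots> = (\<integral>\<^sup>+x. ennreal (exp (- (2 * t) * (norm x)\<^sup>2)) \<partial>(lborel :: (real^'d) measure))"
      unfolding theta_eq
      by (rule nn_integral_periodization[of "\<lambda>x. ennreal (exp (- (2 * t) * (norm x)\<^sup>2))"]) measurable
    also have "\<dots> = ennreal ((pi / (2 * t)) powr h)"
      unfolding h_def using t by (intro nn_integral_gaussian) simp
    finally show ?thesis by simp
  qed
  have "(\<integral>\<^sup>+z\<in>\<Omega>. S z \<partial>lborel) = (\<Sum>j\<in>J. (\<integral>\<^sup>+z\<in>\<Omega>. theta (2 * t) (z - x j) \<partial>lborel))"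
    unfolding S_def by (simp add: sum_distrib_right nn_integral_sum)
  also have "\<dots> = ennreal (real (card J) * (pi / (2 * t)) powr h)"
    by (simp add: mean ennreal_mult ennreal_of_nat_eq_real_of_nat)
  finally have S: "(\<integral>\<^sup>+z\<in>\<Omega>. S z \<partial>lborel) = ennreal (real (card J) * (pi / (2 * t)) powr h)" .
  \<comment> \<open>Cauchy-Schwarz against the indicator of \<open>\<Omega>\<close>, whose square
    integrates to 1.\<close>
  have "(\<integral>\<^sup>+z. (S z * indicator \<Omega> z) * indicator \<Omega> z \<partial>lborel)\<^sup>2
      \<le> (\<integral>\<^sup>+z. (S z * indicator \<Omega> z)\<^sup>2 \<partial>lborel) * (\<integral>\<^sup>+z. (indicator \<Omega> z)\<^sup>2 \<partial>lborel)"
    by (rule Cauchy_Schwarz_nn_integral) measurable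
  also have "(\<integral>\<^sup>+z. (indicator \<Omega> z)\<^sup>2 \<partial>lborel) = (\<integral>\<^sup>+z. indicator \<Omega> z \<partial>lborel)"
    by (intro nn_integral_cong) (auto simp: indicator_def)
  also have "\<dots> = 1"
    by (simp add: emeasure_fund_domain)
  also have "(\<integral>\<^sup>+z. (S z * indicator \<Omega> z) * indicator \<Omega> z \<partial>lborel) = (\<integral>\<^sup>+z\<in>\<Omega>. S z \<partial>lborel)"
    by (intro nn_integral_cong) (auto simp: indicator_def)
  also have "(\<integral>\<^sup>+z. (S z * indicator \<Omega> z)\<^sup>2 \<partial>lborel)
      = (\<integral>\<^sup>+z. (\<Sum>j\<in>J. \<Sum>k\<in>J. theta (2 * t) (z - x j) * theta (2 * t) (z - x k) * indicator \<Omega> z) \<partial>lborel)"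
    by (intro nn_integral_cong)
      (auto simp: indicator_def S_def power2_eq_square sum_product)
  also have "\<dots> = (\<Sum>j\<in>J. \<Sum>k\<in>J. (\<integral>\<^sup>+z\<in>\<Omega>. theta (2 * t) (z - x j) * theta (2 * t) (z - x k) \<partial>lborel))"
    by (simp add: nn_integral_sum)
  also have "\<dots> = (\<Sum>j\<in>J. \<Sum>k\<in>J. ?K * theta t (x j - x k))"
    by (simp only: nn_integral_theta_product[OF t] h_def)
  also have "\<dots> = ?K * (\<Sum>j\<in>J. \<Sum>k\<in>J. theta t (x j - x k))"
    by (simp only: sum_distrib_left)
  finally have le: "(ennreal (real (card J) * (pi / (2 * t)) powr h))\<^sup>2 \<le> ?K * (\<Sum>j\<in>J. \<Sum>k\<in>J. theta t (x j - x k))"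
    by (simp only: S mult_1_right)
  have "(real (card J) * (pi / (2 * t)) powr h)\<^sup>2 = (pi / (4 * t)) powr h * ((real (card J))\<^sup>2 * (pi / t) powr h)"
  proof -
    have "((pi / (2 * t)) powr h)\<^sup>2 = (pi / (2 * t) * (pi / (2 * t))) powr h"
      using t by (simp add: powr_mult[symmetric] power2_eq_square)
    also have "pi / (2 * t) * (pi / (2 * t)) = pi / (4 * t) * (pi / t)"
      using t by (simp add: field_simps)
    also have "\<dots> powr h = (pi / (4 * t)) powr h * (pi / t) powr h"
      by (simp only: powr_mult)
    finally show ?thesis
      by (simp add: power_mult_distrib)
  qed
  then have "?K * ennreal ((real (card J))\<^sup>2 * (pi / t) powr h) \<le> ?K * (\<Sum>j\<in>J. \<Sum>k\<in>J. theta t (x j - x k))"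
    using le by (simp add: ennreal_power ennreal_mult[symmetric])
  moreover have "?K \<noteq> 0" "?K \<noteq> \<infinity>"
    using t by simp_all
  ultimately show ?thesis
    unfolding h_def by (simp add: ennreal_mult_le_mult_iff)
qed

text \<open>\<open>D\<close> is the truncated lattice sum at 0, the contribution of each diagonal
  pair; it depends on \<open>T\<close> but not on the points. Integrating the bound for
  \<open>theta\<close> over \<open>{1<..T}\<close> gives the left side, and off the diagonal the
  truncation is dropped at the end since it only lowers the sum.\<close>

lemma real_part_sum_ge:
  assumes s: "0 < s" "s < real CARD('d)" and T: "1 \<le> T"
  obtains D where "0 \<le> D"
    "\<And>(J :: 'i set) x. finite J \<Longrightarrow>
      ennreal ((real (card J))\<^sup>2 * (riesz_constant TYPE('d) s * (1 - T powr ((s - real CARD('d)) / 2))))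
      \<le> (\<Sum>j\<in>J. \<Sum>k\<in>J - {j}. real_part s (x j - x k)) + ennreal (real (card J) * D)"
proof -
  define h where "h = real CARD('d) / 2"
  let ?A = "\<lambda>u. \<integral>\<^sup>+t\<in>{1<..T}. theta t u \<partial>riesz_measure s"
  let ?C = "riesz_constant TYPE('d) s * (1 - T powr ((s - real CARD('d)) / 2))"
  have CT: "(\<integral>\<^sup>+t\<in>{1<..T}. ennreal ((pi / t) powr h) \<partial>riesz_measure s) = ennreal ?C"
    unfolding h_def by (rule nn_integral_riesz_truncated) fact+
  have th1: "theta 1 0 < \<infinity>"
    using nn_integral_gaussian_lattice_finite[of 1] by (simp add: theta_eq)
  \<comment> \<open>The factor \<open>(T / pi) powr h\<close> makes
    \<open>(T / pi) powr h * (pi / t) powr h\<close> at least 1 for \<open>t \<le> T\<close>, so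
    that finiteness of the diagonal term follows from the integral computed in
    \<open>CT\<close>.\<close>
  let ?M = "theta 1 0 * ennreal ((T / pi) powr h)"
  have "?A 0 \<le> (\<integral>\<^sup>+t. ?M * (ennreal ((pi / t) powr h) * indicator {1<..T} t) \<partial>riesz_measure s)"
  proof (rule nn_integral_mono)
    fix t :: real
    show "theta t 0 * indicator {1<..T} t \<le> ?M * (ennreal ((pi / t) powr h) * indicator {1<..T} t)"
    proof (cases "t \<in> {1<..T}")
      case True
      then have t: "1 < t" "t \<le> T" by auto
      have "theta t 0 \<le> theta 1 0"
        unfolding theta_def using t
        by (intro nn_integral_mono ennreal_leI) (simp add: mult_le_cancel_left1)
      moreover have "1 \<le> (T / pi) powr h * (pi / t) powr h"
      proof -
        have "(T / pi) powr h * (pi / t) powr h = (T / pi * (pi / t)) powr h"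
          by (simp only: powr_mult)
        also have "T / pi * (pi / t) = T / t"
          by simp
        also have "1 \<le> (T / t) powr h"
          using t by (intro ge_one_powr_ge_zero) (auto simp: h_def)
        finally show ?thesis .
      qed
      then have "1 \<le> ennreal ((T / pi) powr h) * ennreal ((pi / t) powr h)"
        by (simp add: ennreal_mult[symmetric] ennreal_1[symmetric] ennreal_leI del: ennreal_1)
      ultimately have "theta t 0 * 1 \<le> theta 1 0 * (ennreal ((T / pi) powr h) * ennreal ((pi / t) powr h))"
        by (intro mult_mono) auto
      then show ?thesis
        using True by (simp add: mult.assoc)
    qed simp
  qed
  also have "\<dots> = ?M * ennreal ?C"
    unfolding CT[symmetric] by (rule nn_integral_cmult) measurable
  also have "\<dots> < \<infinity>"
    using th1 by (simp add: ennreal_mult_less_top)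
  finally obtain D where D: "0 \<le> D" "?A 0 = ennreal D"
    by (metis infinity_ennreal_def less_top_ennreal)
  show thesis
  proof (rule that[OF D(1)])
    fix J :: "'i set" and x :: "'i \<Rightarrow> real^'d"
    assume J: "finite J"
    have "ennreal ((real (card J))\<^sup>2 * ?C)
        = (\<integral>\<^sup>+t. ennreal ((real (card J))\<^sup>2) * (ennreal ((pi / t) powr h) * indicator {1<..T} t) \<partial>riesz_measure s)"
      by (simp add: nn_integral_cmult CT ennreal_mult')
    also have "\<dots> \<le> (\<integral>\<^sup>+t. (\<Sum>j\<in>J. \<Sum>k\<in>J. theta t (x j - x k) * indicator {1<..T} t) \<partial>riesz_measure s)"
    proof (rule nn_integral_mono)
      fix t :: real
      show "ennreal ((real (card J))\<^sup>2) * (ennreal ((pi / t) powr h) * indicator {1<..T} t)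
          \<le> (\<Sum>j\<in>J. \<Sum>k\<in>J. theta t (x j - x k) * indicator {1<..T} t)"
        using theta_positive_definite[OF _ J, of t x]
        by (cases "t \<in> {1<..T}") (auto simp: ennreal_mult h_def)
    qed
    also have "\<dots> = (\<Sum>j\<in>J. \<Sum>k\<in>J. ?A (x j - x k))"
      by (simp add: nn_integral_sum)
    also have "\<dots> = (\<Sum>j\<in>J. (\<Sum>k\<in>J - {j}. ?A (x j - x k)) + ennreal D)"
      by (intro sum.cong refl) (use J D in \<open>simp add: sum.remove add.commute\<close>)
    also have "\<dots> = (\<Sum>j\<in>J. \<Sum>k\<in>J - {j}. ?A (x j - x k)) + ennreal (real (card J) * D)"
      using D by (simp add: sum.distrib ennreal_mult ennreal_of_nat_eq_real_of_nat)
    also have "\<dots> \<le> (\<Sum>j\<in>J. \<Sum>k\<in>J - {j}. real_part s (x j - x k)) + ennreal (real (card J) * D)"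
      unfolding real_part_eq
      by (intro add_right_mono sum_mono nn_integral_mono) (auto simp: indicator_def)
    finally show "ennreal ((real (card J))\<^sup>2 * ?C)
        \<le> (\<Sum>j\<in>J. \<Sum>k\<in>J - {j}. real_part s (x j - x k)) + ennreal (real (card J) * D)" .
  qed
qed

end

subsection \<open>Minimal energy\<close>

text \<open>The integrals P and Q of the positive and negative part of \<open>f - b\<close> satisfy
  \<open>P + b = (c + b) + Q\<close>. On a probability space Q is at most b, hence finite, and the
  difference is c.\<close>

lemma ereal_integral_diff_const:
  assumes f [measurable]: "f \<in> borel_measurable M" and "emeasure M (space M) = 1"
    and c: "0 \<le> c" and b: "0 \<le> b" and int: "(\<integral>\<^sup>+x. f x \<partial>M) = ennreal (c + b)"
  shows "ereal_integral M (\<lambda>x. enn2ereal (f x) - ereal b) = ereal c"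
proof -
  \<comment> \<open>Subtraction in \<open>ennreal\<close> is cut off at 0, so \<open>a - b\<close>
    and \<open>b - a\<close> are the positive and the negative part.\<close>
  have pos: "e2ennreal (enn2ereal a - ereal b) = a - ennreal b" for a
    using b by (cases a) (auto simp: ennreal_minus)
  have neg: "e2ennreal (- (enn2ereal a - ereal b)) = ennreal b - a" for a
    using b by (cases a) (auto simp: ennreal_minus e2ennreal_neg)
  have eq: "(a - ennreal b) + ennreal b = a + (ennreal b - a)" for a
  proof (cases a)
    case (real r)
    then show ?thesis
      using b by (cases "b \<le> r") (simp_all add: ennreal_minus ennreal_neg flip: ennreal_plus)
  qed simp
  define P where "P = (\<integral>\<^sup>+x. f x - ennreal b \<partial>M)"
  define Q where "Q = (\<integral>\<^sup>+x. ennreal b - f x \<partial>M)"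
  have const: "(\<integral>\<^sup>+x. ennreal b \<partial>M) = ennreal b"
    using assms by simp
  have "P + ennreal b = (\<integral>\<^sup>+x. (f x - ennreal b) + ennreal b \<partial>M)"
    unfolding P_def by (subst nn_integral_add) (simp_all add: assms(2))
  also have "\<dots> = (\<integral>\<^sup>+x. f x + (ennreal b - f x) \<partial>M)"
    by (simp only: eq)
  also have "\<dots> = ennreal (c + b) + Q"
    unfolding Q_def by (subst nn_integral_add) (simp_all add: int)
  finally have PQ: "P + ennreal b = ennreal (c + b) + Q" .
  have "Q \<le> (\<integral>\<^sup>+x. ennreal b \<partial>M)"
    unfolding Q_def by (intro nn_integral_mono) simp
  then have "Q < \<infinity>"
    unfolding const by (rule le_less_trans) simp
  then obtain q where q: "Q = ennreal q" "0 \<le> q"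
    by (cases Q) auto
  have "P = ennreal (c + q)"
  proof (cases P)
    case (real p)
    then have "ennreal (p + b) = ennreal (c + b + q)"
      using PQ q b c by simp
    then have "p + b = c + b + q"
      using real b c q by (subst (asm) ennreal_inj) auto
    then have "p = c + q"
      by simp
    then show ?thesis
      using real by simp
  next
    case top
    then have "ennreal (c + b) + ennreal q = top"
      using PQ q by simp
    then show ?thesis
      by (simp only: ennreal_add_eq_top ennreal_neq_top simp_thms)
  qed
  then show ?thesis
    using q c by (simp add: ereal_integral_def pos neg del: ennreal_plus flip: P_def Q_def)
qed

lemma sum_enn2ereal_plus_ereal:
  "(\<Sum>i\<in>I. enn2ereal (a i) + ereal (r i)) = enn2ereal (\<Sum>i\<in>I. a i) + ereal (\<Sum>i\<in>I. r i)"
proof (induction I rule: infinite_finite_induct)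
  case (insert i I)
  then show ?case
    by (cases "a i"; cases "\<Sum>i\<in>I. a i") (simp_all flip: ennreal_plus)
qed (simp_all add: zero_ennreal.rep_eq flip: zero_ereal_def)

context unimodular_basis
begin

text \<open>The kernel raised by the constant \<open>dual_part s 0\<close>, which makes it
  nonnegative.\<close>

definition potential :: "real \<Rightarrow> real^'d \<Rightarrow> ennreal" where
  "potential s u = real_part s u + ennreal (dual_part s u + dual_part s 0)"

lemma kernel_eq_parts:
  assumes "0 < s"
  shows "periodic_riesz_kernel V s x y = enn2ereal (real_part s (x - y)) + ereal (dual_part s (x - y))"
  unfolding periodic_riesz_kernel_def riesz_coeff_def[symmetric] Re_dual_sum[OF assms]
    infsum_ennreal_eq_nn_integral[OF countable_lattice] real_part_def ..

lemma kernel_eq_potential: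
  assumes "0 < s"
  shows "periodic_riesz_kernel V s x y = enn2ereal (potential s (x - y)) - ereal (dual_part s 0)"
  unfolding kernel_eq_parts[OF assms] potential_def using ennreal_dual_part(2)[OF assms, of "x - y"]
  by (cases "real_part s (x - y)") (simp_all flip: ennreal_plus)

lemma measurable_dual_part:
  assumes "0 < s"
  shows "(\<lambda>u. ennreal (dual_part s u + dual_part s 0)) \<in> borel_measurable borel"
  unfolding ennreal_dual_part(1)[OF assms]
  by (rule borel_measurable_nn_integral_count_space[OF countable_dual]) measurable

lemma measurable_potential:
  assumes "0 < s"
  shows "potential s \<in> borel_measurable borel"
  unfolding potential_def using measurable_dual_part[OF assms] by measurable

lemma potential_uminus: "potential s (- u) = potential s u"
  by (simp add: potential_def real_part_uminus dual_part_uminus)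

text \<open>By periodicity the mean is independent of the centre \<open>a\<close>. It therefore
  serves both for the integral of the kernel and for every step of the greedy choice of
  points.\<close>

lemma nn_integral_potential:
  assumes s: "0 < s" "s < real CARD('d)"
  shows "(\<integral>\<^sup>+u\<in>\<Omega>. potential s (u - a) \<partial>lborel) = ennreal (riesz_constant TYPE('d) s + dual_part s 0)"
proof -
  note [measurable] = measurable_potential[OF s(1)] measurable_dual_part[OF s(1)]
  have "(\<integral>\<^sup>+u\<in>\<Omega>. potential s (u + - a) \<partial>lborel) = (\<integral>\<^sup>+u\<in>\<Omega>. potential s u \<partial>lborel)"
    by (rule nn_integral_fund_domain_shift, measurable)
      (simp add: potential_def real_part_periodic dual_part_periodic)
  also have "\<dots> = (\<integral>\<^sup>+u. real_part s u * indicator \<Omega> u + ennreal (dual_part s u + dual_part s 0) * indicator \<Omega> u \<partial>lborel)"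
    by (simp add: potential_def distrib_right)
  also have "\<dots> = ennreal (riesz_constant TYPE('d) s) + ennreal (dual_part s 0)"
    by (subst nn_integral_add) (simp_all add: nn_integral_real_part[OF s] nn_integral_dual_part[OF s(1)])
  also have "\<dots> = ennreal (riesz_constant TYPE('d) s + dual_part s 0)"
    using riesz_constant_pos[OF s] dual_part_0_nonneg[of s] by (simp add: less_imp_le)
  finally show ?thesis by simp
qed

lemma ereal_integral_kernel:
  assumes s: "0 < s" "s < real CARD('d)"
  shows "ereal_integral (restrict_space lborel \<Omega>) (\<lambda>x. periodic_riesz_kernel V s x y)
    = ereal (riesz_constant TYPE('d) s)"
proof -
  note [measurable] = measurable_potential[OF s(1)]
  show ?thesis
    unfolding kernel_eq_potential[OF s(1)]
  proof (rule ereal_integral_diff_const)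
    show "(\<lambda>x. potential s (x - y)) \<in> borel_measurable (restrict_space lborel \<Omega>)"
      by (rule measurable_restrict_space1) measurable
    show "emeasure (restrict_space lborel \<Omega>) (space (restrict_space lborel \<Omega>)) = 1"
      by (simp add: emeasure_restrict_space space_restrict_space emeasure_fund_domain)
    show "0 \<le> riesz_constant TYPE('d) s"
      using riesz_constant_pos[OF s] by simp
    show "(\<integral>\<^sup>+x. potential s (x - y) \<partial>restrict_space lborel \<Omega>) = ennreal (riesz_constant TYPE('d) s + dual_part s 0)"
      by (simp add: nn_integral_restrict_space nn_integral_potential[OF s])
  qed (rule dual_part_0_nonneg)
qed

text \<open>Otherwise \<open>g\<close> would exceed its mean everywhere on \<open>\<Omega>\<close>,
  a set of measure 1.\<close>

lemma ex_le_mean: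
  assumes [measurable]: "g \<in> borel_measurable borel" and g: "(\<integral>\<^sup>+u\<in>\<Omega>. g u \<partial>lborel) = ennreal m"
  obtains y where "y \<in> \<Omega>" "g y \<le> ennreal m"
proof -
  have "\<exists>y\<in>\<Omega>. g y \<le> ennreal m"
  proof (rule ccontr)
    assume *: "\<not> ?thesis"
    have mean: "(\<integral>\<^sup>+u\<in>\<Omega>. ennreal m \<partial>lborel) = ennreal m"
      by (simp add: nn_integral_cmult_indicator emeasure_fund_domain)
    have "(\<integral>\<^sup>+u\<in>\<Omega>. ennreal m \<partial>lborel) < (\<integral>\<^sup>+u\<in>\<Omega>. g u \<partial>lborel)"
    proof (rule nn_integral_less)
      show "(\<integral>\<^sup>+u\<in>\<Omega>. ennreal m \<partial>lborel) \<noteq> \<infinity>"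
        by (simp add: mean)
      show "AE u in lborel. ennreal m * indicator \<Omega> u \<le> g u * indicator \<Omega> u"
        using * by (intro AE_I2) (auto simp: indicator_def not_le less_imp_le)
      show "\<not> (AE u in lborel. g u * indicator \<Omega> u \<le> ennreal m * indicator \<Omega> u)"
      proof
        assume "AE u in lborel. g u * indicator \<Omega> u \<le> ennreal m * indicator \<Omega> u"
        then have "AE u in lborel. u \<notin> \<Omega>"
        proof eventually_elim
          case (elim u)
          then show ?case
            using * by (cases "u \<in> \<Omega>") auto
        qed
        then have "emeasure lborel {u \<in> space lborel. u \<in> \<Omega>} = 0"
          by (rule emeasure_eq_0_AE)
        then show False
          by (simp add: emeasure_fund_domain)
      qed
    qed measurable
    then show False
      by (simp add: mean g)
  qed
  then show thesis
    using that by blast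
qed

lemma ex_config_potential_le:
  assumes s: "0 < s" "s < real CARD('d)"
  shows "\<exists>x. (\<forall>j. x j \<in> \<Omega>) \<and> (\<Sum>j<N. \<Sum>k\<in>{..<N} - {j}. potential s (x j - x k))
    \<le> ennreal (real (N * (N - 1)) * (riesz_constant TYPE('d) s + dual_part s 0))"
proof (induction N)
  case 0
  \<comment> \<open>Configurations are total functions into \<open>\<Omega>\<close> here, so even
    the empty one needs a point.\<close>
  have "\<Omega> \<noteq> {}"
    using emeasure_fund_domain by auto
  then show ?case by auto
next
  case (Suc N)
  note [measurable] = measurable_potential[OF s(1)]
  let ?m = "riesz_constant TYPE('d) s + dual_part s 0"
  have m: "0 \<le> ?m"
    using riesz_constant_pos[OF s] dual_part_0_nonneg[of s] by simp
  obtain x where x: "\<And>j. x j \<in> \<Omega>"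
    "(\<Sum>j<N. \<Sum>k\<in>{..<N} - {j}. potential s (x j - x k)) \<le> ennreal (real (N * (N - 1)) * ?m)"
    using Suc by blast
  have "(\<integral>\<^sup>+u\<in>\<Omega>. (\<Sum>j<N. potential s (u - x j)) \<partial>lborel) = (\<Sum>j<N. ennreal ?m)"
  proof -
    have "(\<integral>\<^sup>+u. (\<Sum>j<N. potential s (u - x j) * indicator \<Omega> u) \<partial>lborel)
        = (\<Sum>j<N. (\<integral>\<^sup>+u\<in>\<Omega>. potential s (u - x j) \<partial>lborel))"
      by (rule nn_integral_sum) measurable
    then show ?thesis
      by (simp only: sum_distrib_right nn_integral_potential[OF s])
  qed
  also have "\<dots> = ennreal (real N * ?m)"
    using m by (simp add: ennreal_mult ennreal_of_nat_eq_real_of_nat)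
  finally have mean: "(\<integral>\<^sup>+u\<in>\<Omega>. (\<Sum>j<N. potential s (u - x j)) \<partial>lborel) = ennreal (real N * ?m)" .
  have "(\<lambda>u. \<Sum>j<N. potential s (u - x j)) \<in> borel_measurable borel"
    by measurable
  from ex_le_mean[OF this mean] obtain y
    where y: "y \<in> \<Omega>" "(\<Sum>j<N. potential s (y - x j)) \<le> ennreal (real N * ?m)"
    by blast
  \<comment> \<open>The new point occurs in two ordered pairs with each of the N old ones, which
    adds 2N times the mean: \<open>N * (N - 1) + 2 * N = (N + 1) * N\<close>.\<close>
  define x' where "x' = x(N := y)"
  have "(\<Sum>k\<in>{..<Suc N} - {j}. potential s (x' j - x' k))
      = (\<Sum>k\<in>{..<N} - {j}. potential s (x j - x k)) + potential s (y - x j)" if j: "j < N" for j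
  proof -
    have "{..<Suc N} - {j} = insert N ({..<N} - {j})"
      using j by auto
    moreover have "potential s (x j - y) = potential s (y - x j)"
      using potential_uminus[of s "x j - y"] by simp
    moreover have "(\<Sum>k\<in>{..<N} - {j}. potential s (x' j - x' k)) = (\<Sum>k\<in>{..<N} - {j}. potential s (x j - x k))"
      using j by (intro sum.cong) (auto simp: x'_def)
    ultimately show ?thesis
      using j by (simp add: x'_def add.commute)
  qed
  moreover have "(\<Sum>k\<in>{..<Suc N} - {N}. potential s (x' N - x' k)) = (\<Sum>k<N. potential s (y - x k))"
    by (rule sum.cong) (auto simp: x'_def)
  ultimately have "(\<Sum>j<Suc N. \<Sum>k\<in>{..<Suc N} - {j}. potential s (x' j - x' k))
      = (\<Sum>j<N. \<Sum>k\<in>{..<N} - {j}. potential s (x j - x k))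
        + ((\<Sum>j<N. potential s (y - x j)) + (\<Sum>j<N. potential s (y - x j)))"
    by (simp add: sum.distrib add.assoc)
  also have "\<dots> \<le> ennreal (real (N * (N - 1)) * ?m) + (ennreal (real N * ?m) + ennreal (real N * ?m))"
    by (intro add_mono x y)
  also have "\<dots> = ennreal (real (Suc N * (Suc N - 1)) * ?m)"
  proof -
    have "real (Suc N * (Suc N - 1)) * ?m = real (N * (N - 1)) * ?m + (real N * ?m + real N * ?m)"
      by (cases N) (simp_all add: algebra_simps)
    then show ?thesis
      using m by (simp only: ennreal_plus mult_nonneg_nonneg of_nat_0_le_iff add_nonneg_nonneg)
  qed
  finally show ?case
    using x(1) y(1) by (intro exI[of _ x']) (auto simp: x'_def)
qed

text \<open>Returning from the potential to the kernel subtracts \<open>dual_part s 0\<close> once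
  per ordered pair, which cancels the shift in the bound for the greedy configuration.\<close>

lemma energy_le:
  assumes s: "0 < s" "s < real CARD('d)"
  shows "periodic_riesz_energy V s N \<le> ereal (real (N * (N - 1)) * riesz_constant TYPE('d) s)"
proof -
  let ?b = "dual_part s 0" and ?C = "riesz_constant TYPE('d) s"
  let ?P = "{(j, k). j < N \<and> k < N \<and> j \<noteq> k}"
  have P: "?P = (SIGMA j:{..<N}. {..<N} - {j})"
    by auto
  have card: "card ?P = N * (N - 1)"
    unfolding P by (subst card_SigmaI) auto
  obtain x where x: "\<And>j. x j \<in> \<Omega>"
    "(\<Sum>j<N. \<Sum>k\<in>{..<N} - {j}. potential s (x j - x k)) \<le> ennreal (real (N * (N - 1)) * (?C + ?b))"
    using ex_config_potential_le[OF s] by blast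
  \<comment> \<open>The infimum in the energy ranges over extensional functions.\<close>
  define x' where "x' = restrict x {..<N}"
  have "(\<Sum>(j, k)\<in>?P. periodic_riesz_kernel V s (x' j) (x' k))
      = (\<Sum>p\<in>?P. enn2ereal (potential s (x (fst p) - x (snd p))) + ereal (- ?b))"
    by (rule sum.cong) (auto simp: kernel_eq_potential[OF s(1)] x'_def minus_ereal_def)
  also have "\<dots> = enn2ereal (\<Sum>p\<in>?P. potential s (x (fst p) - x (snd p))) + ereal (\<Sum>p\<in>?P. - ?b)"
    by (rule sum_enn2ereal_plus_ereal)
  also have "(\<Sum>p\<in>?P. - ?b) = - (real (N * (N - 1)) * ?b)"
    by (simp add: card)
  also have "(\<Sum>p\<in>?P. potential s (x (fst p) - x (snd p)))
      = (\<Sum>j<N. \<Sum>k\<in>{..<N} - {j}. potential s (x j - x k))"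
    unfolding P by (subst sum.Sigma) (auto intro!: sum.cong)
  also have "enn2ereal (\<Sum>j<N. \<Sum>k\<in>{..<N} - {j}. potential s (x j - x k))
      \<le> ereal (real (N * (N - 1)) * (?C + ?b))"
  proof -
    have "0 \<le> real (N * (N - 1)) * (?C + ?b)"
      using riesz_constant_pos[OF s] dual_part_0_nonneg[of s] by simp
    then show ?thesis
      using x(2) by (simp only: less_eq_ennreal.rep_eq enn2ereal_ennreal)
  qed
  finally have "(\<Sum>(j, k)\<in>?P. periodic_riesz_kernel V s (x' j) (x' k))
      \<le> ereal (real (N * (N - 1)) * (?C + ?b)) + ereal (- (real (N * (N - 1)) * ?b))"
    by (simp add: add_right_mono)
  also have "\<dots> = ereal (real (N * (N - 1)) * ?C)"
    by (simp add: distrib_left)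
  finally have "(\<Sum>(j, k)\<in>?P. periodic_riesz_kernel V s (x' j) (x' k)) \<le> ereal (real (N * (N - 1)) * ?C)" .
  moreover have "x' \<in> {..<N} \<rightarrow>\<^sub>E \<Omega>"
    using x(1) by (auto simp: x'_def)
  ultimately show ?thesis
    unfolding periodic_riesz_energy_def by (rule INF_lower2[rotated])
qed

text \<open>Both pair sums are bounded below with their diagonals included. Removing these costs
  \<open>N * D\<close> for the truncated lattice sum and \<open>N * dual_part s 0\<close> for the
  dual part.\<close>

lemma energy_ge:
  assumes s: "0 < s" "s < real CARD('d)" and T: "1 \<le> T"
  obtains D where "\<And>N :: nat. ereal ((real N)\<^sup>2 * (riesz_constant TYPE('d) s * (1 - T powr ((s - real CARD('d)) / 2))) - real N * D)
      \<le> periodic_riesz_energy V s N"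
proof -
  let ?C = "riesz_constant TYPE('d) s * (1 - T powr ((s - real CARD('d)) / 2))"
  obtain D where D: "0 \<le> D" "\<And>(J :: nat set) x. finite J \<Longrightarrow>
      ennreal ((real (card J))\<^sup>2 * ?C)
      \<le> (\<Sum>j\<in>J. \<Sum>k\<in>J - {j}. real_part s (x j - x k)) + ennreal (real (card J) * D)"
    using real_part_sum_ge[OF s T] by blast
  have C: "0 \<le> ?C"
    using riesz_constant_pos[OF s] T s powr_mono[of "(s - real CARD('d)) / 2" 0 T] by simp
  show thesis
  proof (rule that[of "D + dual_part s 0"])
    fix N :: nat
    let ?P = "{(j, k). j < N \<and> k < N \<and> j \<noteq> k}"
    have P: "?P = (SIGMA j:{..<N}. {..<N} - {j})"
      by auto
    show "ereal ((real N)\<^sup>2 * ?C - real N * (D + dual_part s 0)) \<le> periodic_riesz_energy V s N"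
      unfolding periodic_riesz_energy_def
    proof (rule INF_greatest)
      fix x :: "nat \<Rightarrow> real^'d"
      define R where "R = (\<Sum>j<N. \<Sum>k\<in>{..<N} - {j}. real_part s (x j - x k))"
      define B where "B = (\<Sum>j<N. \<Sum>k\<in>{..<N} - {j}. dual_part s (x j - x k))"
      have "(\<Sum>(j, k)\<in>?P. periodic_riesz_kernel V s (x j) (x k))
          = (\<Sum>p\<in>?P. enn2ereal (real_part s (x (fst p) - x (snd p))) + ereal (dual_part s (x (fst p) - x (snd p))))"
        by (rule sum.cong) (auto simp: kernel_eq_parts[OF s(1)])
      also have "\<dots> = enn2ereal (\<Sum>p\<in>?P. real_part s (x (fst p) - x (snd p))) + ereal (\<Sum>p\<in>?P. dual_part s (x (fst p) - x (snd p)))"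
        by (rule sum_enn2ereal_plus_ereal)
      also have "(\<Sum>p\<in>?P. real_part s (x (fst p) - x (snd p))) = R"
        unfolding P R_def by (subst sum.Sigma) (auto intro!: sum.cong)
      also have "(\<Sum>p\<in>?P. dual_part s (x (fst p) - x (snd p))) = B"
        unfolding P B_def by (subst sum.Sigma) (auto intro!: sum.cong)
      finally have eq: "(\<Sum>(j, k)\<in>?P. periodic_riesz_kernel V s (x j) (x k)) = enn2ereal R + ereal B" .
      have "0 \<le> (\<Sum>j<N. \<Sum>k<N. dual_part s (x j - x k))"
        by (rule dual_part_positive_definite) (simp_all add: s)
      also have "\<dots> = (\<Sum>j<N. dual_part s 0 + (\<Sum>k\<in>{..<N} - {j}. dual_part s (x j - x k)))"
      proof (rule sum.cong)
        fix j assume "j \<in> {..<N}"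
        then show "(\<Sum>k<N. dual_part s (x j - x k)) = dual_part s 0 + (\<Sum>k\<in>{..<N} - {j}. dual_part s (x j - x k))"
          by (subst sum.remove[of _ j]) auto
      qed simp
      also have "\<dots> = real N * dual_part s 0 + B"
        by (simp add: B_def sum.distrib)
      finally have B: "- (real N * dual_part s 0) \<le> B"
        by simp
      have "ennreal ((real N)\<^sup>2 * ?C) \<le> R + ennreal (real N * D)"
        using D(2)[of "{..<N}" x] by (simp add: R_def)
      then have "ereal ((real N)\<^sup>2 * ?C - real N * D) \<le> enn2ereal R"
      proof (cases R)
        case (real r)
        then have "ennreal ((real N)\<^sup>2 * ?C) \<le> ennreal (r + real N * D)"
          using \<open>ennreal ((real N)\<^sup>2 * ?C) \<le> R + ennreal (real N * D)\<close> D(1) by simp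
        then have "(real N)\<^sup>2 * ?C \<le> r + real N * D"
          using real D(1) by (subst (asm) ennreal_le_iff) auto
        then show ?thesis
          using real by simp
      qed simp
      then have "ereal ((real N)\<^sup>2 * ?C - real N * D) + ereal (- (real N * dual_part s 0)) \<le> enn2ereal R + ereal B"
        using B by (intro add_mono) auto
      then show "ereal ((real N)\<^sup>2 * ?C - real N * (D + dual_part s 0))
          \<le> (\<Sum>(j, k)\<in>?P. periodic_riesz_kernel V s (x j) (x k))"
        unfolding eq by (simp add: algebra_simps)
    qed
  qed
qed

text \<open>Above, \<open>N * (N - 1) \<le> N\<^sup>2\<close> suffices. Below, T is first chosen so
  large that the truncated mean exceeds the given \<open>r < C\<close>; then \<open>D\<close> is a
  constant and the diagonal term \<open>D / N\<close> dies out.\<close>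

lemma energy_tendsto:
  assumes s: "0 < s" "s < real CARD('d)"
  shows "(\<lambda>N. periodic_riesz_energy V s N / ereal ((real N)\<^sup>2)) \<longlonglongrightarrow> ereal (riesz_constant TYPE('d) s)"
proof (rule order_tendstoI)
  let ?C = "riesz_constant TYPE('d) s"
  have C: "0 < ?C"
    using s by (rule riesz_constant_pos)
  fix a
  {
    assume a: "ereal ?C < a"
    have "periodic_riesz_energy V s N / ereal ((real N)\<^sup>2) < a" if N: "1 \<le> N" for N
    proof -
      have "periodic_riesz_energy V s N / ereal ((real N)\<^sup>2)
          \<le> ereal (real (N * (N - 1)) * ?C) / ereal ((real N)\<^sup>2)"
        using N by (intro ereal_divide_right_mono energy_le s) auto
      also have "\<dots> = ereal (real (N * (N - 1)) * ?C / (real N)\<^sup>2)"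
        using N by simp
      also have "real (N * (N - 1)) * ?C \<le> (real N)\<^sup>2 * ?C"
        using C N by (intro mult_right_mono) (auto simp: power2_eq_square)
      then have "ereal (real (N * (N - 1)) * ?C / (real N)\<^sup>2) \<le> ereal ?C"
        using N by (simp add: divide_le_eq mult.commute)
      finally show ?thesis
        using a by (rule le_less_trans)
    qed
    then show "\<forall>\<^sub>F N in sequentially. periodic_riesz_energy V s N / ereal ((real N)\<^sup>2) < a"
      using eventually_ge_at_top[of 1] by (rule eventually_mono[rotated]) auto
  next
    assume "a < ereal ?C"
    then obtain r where r: "a < ereal r" "r < ?C"
      using ereal_dense2 by force
    let ?e = "(s - real CARD('d)) / 2"
    have "((\<lambda>T. ?C * (1 - T powr ?e)) \<longlongrightarrow> ?C * (1 - 0)) at_top"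
      using s by (intro tendsto_intros tendsto_neg_powr filterlim_ident) simp
    then have "\<forall>\<^sub>F T in at_top. r < ?C * (1 - T powr ?e)"
      by (rule order_tendstoD) (use r in simp)
    then have "\<forall>\<^sub>F T in at_top. 1 \<le> T \<and> r < ?C * (1 - T powr ?e)"
      using eventually_ge_at_top[of "1::real"] by eventually_elim simp
    then obtain T where T: "1 \<le> T" "r < ?C * (1 - T powr ?e)"
      by (auto dest: eventually_happens)
    obtain D where D: "\<And>N :: nat. ereal ((real N)\<^sup>2 * (?C * (1 - T powr ?e)) - real N * D) \<le> periodic_riesz_energy V s N"
      using energy_ge[OF s T(1)] by blast
    have "(\<lambda>N. ?C * (1 - T powr ?e) - D / real N) \<longlonglongrightarrow> ?C * (1 - T powr ?e) - 0"
      by (intro tendsto_intros lim_const_over_n)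
    then have "\<forall>\<^sub>F N in sequentially. r < ?C * (1 - T powr ?e) - D / real N"
      by (rule order_tendstoD) (use T in simp)
    then show "\<forall>\<^sub>F N in sequentially. a < periodic_riesz_energy V s N / ereal ((real N)\<^sup>2)"
      using eventually_ge_at_top[of 1]
    proof eventually_elim
      case (elim N)
      have "a < ereal (?C * (1 - T powr ?e) - D / real N)"
        using r(1) elim(1) by (meson ereal_less(3) less_trans less_ereal.simps(1))
      also have "?C * (1 - T powr ?e) - D / real N
          = ((real N)\<^sup>2 * (?C * (1 - T powr ?e)) - real N * D) / (real N)\<^sup>2"
        using elim(2) by (simp add: diff_divide_distrib power2_eq_square)
      also have "ereal \<dots> = ereal ((real N)\<^sup>2 * (?C * (1 - T powr ?e)) - real N * D) / ereal ((real N)\<^sup>2)"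
        using elim(2) by simp
      also have "\<dots> \<le> periodic_riesz_energy V s N / ereal ((real N)\<^sup>2)"
        using elim(2) by (intro ereal_divide_right_mono D) auto
      finally show ?case .
    qed
  }
qed

end

theorem corollary3p5:
  fixes V :: "real^'d^'d" and s :: real
  assumes "independent (columns V)" and "det V = 1"
    and "0 < s" and "s < CARD('d)"
  shows "((\<lambda>N. periodic_riesz_energy V s N / ereal ((real N)\<^sup>2)) \<longlonglongrightarrow>
           ereal_integral (restrict_space lborel (fund_domain V)) (\<lambda>y.
             ereal_integral (restrict_space lborel (fund_domain V)) (\<lambda>x.
               periodic_riesz_kernel V s x y)))
       \<and> ereal_integral (restrict_space lborel (fund_domain V)) (\<lambda>y.
             ereal_integral (restrict_space lborel (fund_domain V)) (\<lambda>x.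
               periodic_riesz_kernel V s x y))
         = ereal (2 * pi powr (CARD('d) / 2) / (Gamma (s/2) * (CARD('d) - s)))"
proof -
  interpret unimodular_basis V
    by standard fact
  let ?C = "riesz_constant TYPE('d) s"
  have C: "0 < ?C"
    using assms(3,4) by (rule riesz_constant_pos)
  \<comment> \<open>The inner integral is the same for all \<open>y\<close>, so the outer one has a
    constant integrand: the case of shift 0 in \<open>ereal_integral_diff_const\<close>.\<close>
  have "ereal_integral (restrict_space lborel \<Omega>) (\<lambda>y. enn2ereal (ennreal ?C) - ereal 0) = ereal ?C"
    using C by (intro ereal_integral_diff_const)
      (simp_all add: emeasure_restrict_space space_restrict_space emeasure_fund_domain)
  then have "ereal_integral (restrict_space lborel \<Omega>) (\<lambda>y.
      ereal_integral (restrict_space lborel \<Omega>) (\<lambda>x. periodic_riesz_kernel V s x y)) = ereal ?C"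
    using C by (simp add: ereal_integral_kernel[OF assms(3,4)] less_imp_le)
  then show ?thesis
    using energy_tendsto[OF assms(3,4)] by (simp only: riesz_constant_def)
qed

end
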